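(* Let $\mathcal{A}(\mathcal{S})$ be an LP algebra of rank $n$ and let $(\mathbf{x}_{t_1},\mathbf{F}_{t_1})$, $(\mathbf{x}_{t_2},\mathbf{F}_{t_2})$ be two LP seeds of the LP pattern $\mathcal{S}$. (1) Suppose there are a permutation $\sigma$ of $[1,n]$ and units $r_i\in R$ such that $x_{i;t_2}=r_i\,x_{\sigma(i);t_1}$ for all $i\in[1,n]$. Then for every $i\in[1,n]$ there is a unit $r'_i\in R$ such that $F_{i;t_2}=r'_i\,F_{\sigma(i);t_1}$, where each exchange polynomial $F_{j;t}$ is regarded as the element $F_{j;t}(x_{1;t},\dots,x_{n;t})$ of $\mathcal{F}$. (2) Consequently each LP seed of $\mathcal{A}(\mathcal{S})$ is uniquely determined, up to equivalence and reindexing, by its cluster.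
   Context: $R$ is a unique factorization domain containing $\mathbb{Z}$, $n\ge1$, and $\mathcal{F}$ is the field of rational functions in $n$ independent variables over $\mathrm{Frac}(R)$. For a rational function $F$, write $x_i\in F$ if $F$ involves $x_i$, and $x_i\notin F$ otherwise; $F|_{x_j\leftarrow N}$ denotes substitution of $N$ for $x_j$. An LP seed of rank $n$ is a pair $(\mathbf{x},\mathbf{F})$ where $\mathbf{x}=\{x_1,\dots,x_n\}$ (the cluster; its elements are cluster variables) is a transcendence basis of $\mathcal{F}$ over $\mathrm{Frac}(R)$, and $\mathbf{F}=\{F_1,\dots,F_n\}$ (exchange polynomials) are irreducible polynomials in $R[x_1,\dots,x_n]$ such that for all $i,j$, $x_j$ does not divide $F_i$ and $x_i\notin F_i$. The exchange Laurent polynomial is $\hat F_j=F_j/\prod_{k\neq j}x_k^{a_k}$, where $a_k\in\mathbb{Z}_{\ge0}$ is maximal such that $F_k^{a_k}$ divides $F_j|_{x_k\leftarrow F_k/x'_k}$ in $R[x_1,\dots,x_{k-1},(x'_k)^{-1},x_{k+1},\dots,x_n]$ ($x'_k$ a new indeterminate). LP mutation in direction $k$: $\mu_k(\mathbf{x},\mathbf{F})=(\mathbf{x}',\mathbf{F}')$ with $x'_k=\hat F_k/x_k$, $x'_i=x_i$ ($i\ne k$); $F'_k=F_k$; if $x_k\notin F_i$ then $F'_i=F_i$ (up to a unit of $R$); if $x_k\in F_i$, put $N_k=(\hat F_k|_{x_i\leftarrow0})/x'_k$, $G_i=F_i|_{x_k\leftarrow N_k}$, let $H_i$ be $G_i$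 with all common factors (in $R[x_1,\dots,\widehat{x_i},\dots,\widehat{x_k},\dots,x_n]$) with $\hat F_k|_{x_i\leftarrow0}$ removed, and $F'_i=MH_i$ where $M$ is a Laurent monomial in $\{x'_j\}_{j\ne i}$ with unit coefficient such that $F'_i\in R[x'_1,\dots,x'_n]$ is not divisible by any $x'_j$. The result is again an LP seed, defined up to unit factors. Two LP seeds $\Sigma_{t_1},\Sigma_{t_2}$ are equivalent if for each $i$ there are units $r_i,r'_i\in R$ with $x_{i;t_2}=r_ix_{i;t_1}$ and $F_{i;t_2}=r'_iF_{i;t_1}$; $[\Sigma]$ denotes the equivalence class, and $\mu_k[\Sigma]:=[\mu_k\Sigma]$ is well defined. An LP pattern $\mathcal{S}$ assigns an LP seed $\Sigma_t=(\mathbf{x}_t,\mathbf{F}_t)$, $\mathbf{x}_t=\{x_{1;t},\dots,x_{n;t}\}$, $\mathbf{F}_t=\{F_{1;t},\dots,F_{n;t}\}$, to each vertex $t$ of the $n$-regular tree $\mathbb{T}_n$ so that seeds at vertices joined by an edge labeled $k$ are related by $\mu_k$. The LP algebra $\mathcal{A}(\mathcal{S})$ is the $R$-subalgebra of $\mathcal{F}$ generated by all cluster variables of $\mathcal{S}$; its LP seeds are the seeds of $\mathcal{S}$. *)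

theory Defs
  imports "HOL-Library.Poly_Mapping" "HOL-Computational_Algebra.Fraction_Field"
          "HOL-Computational_Algebra.Factorial_Ring"
begin

text \<open>Polynomials in the indeterminates X_0, X_1, ... over R (variable j <-> index j;
  the rank-n variables are X_0 .. X_(n-1), i.e. the paper's x_1..x_n shifted by one).\<close>
type_synonym 'a mpoly = "(nat \<Rightarrow>\<^sub>0 nat) \<Rightarrow>\<^sub>0 'a"

definition vars :: "'a::zero mpoly \<Rightarrow> nat set" where
  "vars p = (\<Union>\<alpha>\<in>Poly_Mapping.keys p. Poly_Mapping.keys (\<alpha> :: nat \<Rightarrow>\<^sub>0 nat))"

definition in_vars :: "nat \<Rightarrow> 'a::zero mpoly \<Rightarrow> bool" where
  "in_vars n p \<longleftrightarrow> vars p \<subseteq> {..<n}"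

definition Const :: "'a::zero \<Rightarrow> 'a mpoly" where
  "Const c = Poly_Mapping.single 0 c"

definition Var :: "nat \<Rightarrow> 'a::{zero,one} mpoly" where
  "Var j = Poly_Mapping.single (Poly_Mapping.single j 1) 1"

definition monom1 :: "(nat \<Rightarrow>\<^sub>0 nat) \<Rightarrow> 'a::{zero,one} mpoly" where
  "monom1 \<alpha> = Poly_Mapping.single \<alpha> 1"

definition eval_mp :: "('a::zero \<Rightarrow> 'b::comm_semiring_1) \<Rightarrow> (nat \<Rightarrow> 'b) \<Rightarrow> 'a mpoly \<Rightarrow> 'b" where
  "eval_mp c v p = (\<Sum>\<alpha>\<in>Poly_Mapping.keys p. c (Poly_Mapping.lookup p \<alpha>) * (\<Prod>j\<in>Poly_Mapping.keys \<alpha>. v j ^ Poly_Mapping.lookup \<alpha> j))"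

definition subst_mp :: "(nat \<Rightarrow> 'a::comm_semiring_1 mpoly) \<Rightarrow> 'a mpoly \<Rightarrow> 'a mpoly" where
  "subst_mp s p = eval_mp Const s p"

type_synonym 'a ratfun = "'a mpoly fract"

definition to_fr :: "'a::{factorial_semiring,idom,ring_char_0} mpoly \<Rightarrow> 'a ratfun" where
  "to_fr p = Fract p 1"

definition ratfield :: "nat \<Rightarrow> 'a::{factorial_semiring,idom,ring_char_0} ratfun set" where
  "ratfield n = {Fract p q | p q. q \<noteq> 0 \<and> in_vars n p \<and> in_vars n q}"

definition evalF :: "(nat \<Rightarrow> 'a::{factorial_semiring,idom,ring_char_0} ratfun) \<Rightarrow> 'a mpoly \<Rightarrow> 'a ratfun" where
  "evalF x p = eval_mp (\<lambda>c. to_fr (Const c)) x p"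

text \<open>Transcendence basis of F over Frac(R): x_0..x_(n-1) lie in F, are algebraically
  independent, and every element f of F is algebraic over Frac(R)(x), i.e. P(x,f) = 0 for a
  nonzero P in R[X_0..X_n] (given independence of x, P(x,Y) \<noteq> 0 iff P \<noteq> 0;
  clearing denominators, relations over Frac(R) are the same as over R).\<close>
definition alg_indep :: "nat \<Rightarrow> (nat \<Rightarrow> 'a::{factorial_semiring,idom,ring_char_0} ratfun) \<Rightarrow> bool" where
  "alg_indep n x \<longleftrightarrow> (\<forall>p. in_vars n p \<longrightarrow> evalF x p = 0 \<longrightarrow> p = 0)"

definition trans_basis :: "nat \<Rightarrow> (nat \<Rightarrow> 'a::{factorial_semiring,idom,ring_char_0} ratfun) \<Rightarrow> bool" where
  "trans_basis n x \<longleftrightarrow>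
     (\<forall>i<n. x i \<in> ratfield n) \<and> alg_indep n x \<and>
     (\<forall>f \<in> ratfield n. \<exists>P. in_vars (Suc n) P \<and> P \<noteq> 0 \<and> evalF (x(n := f)) P = 0)"

text \<open>A seed: cluster x (indices < n) and exchange polynomials F (indices < n).\<close>
type_synonym 'a seed = "(nat \<Rightarrow> 'a ratfun) \<times> (nat \<Rightarrow> 'a mpoly)"

definition is_LP_seed :: "nat \<Rightarrow> 'a::{factorial_semiring,idom,ring_char_0} seed \<Rightarrow> bool" where
  "is_LP_seed n S \<longleftrightarrow> (let x = fst S; F = snd S in
     trans_basis n x \<and>
     (\<forall>i<n. in_vars n (F i) \<and> irreducible (F i) \<and> i \<notin> vars (F i) \<and>
            (\<forall>j<n. \<not> Var j dvd F i)))"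

text \<open>Exponent a_k in the exchange Laurent polynomial of F_j: maximal a such that
  F_k^a divides F_j with x_k replaced by F_k / x'_k in R[..., (x'_k)^(-1), ...]; the
  indeterminate (x'_k)^(-1) is represented by X_k itself (F_k does not involve X_k).\<close>
definition exch_exp :: "(nat \<Rightarrow> 'a::{factorial_semiring,idom,ring_char_0} mpoly) \<Rightarrow> nat \<Rightarrow> nat \<Rightarrow> nat" where
  "exch_exp F j k = (GREATEST a. F k ^ a dvd subst_mp (\<lambda>l. if l = k then F k * Var k else Var l) (F j))"

definition exch_den :: "nat \<Rightarrow> (nat \<Rightarrow> 'a::{factorial_semiring,idom,ring_char_0} mpoly) \<Rightarrow> nat \<Rightarrow> nat set \<Rightarrow> 'a mpoly" where
  "exch_den n F j E = (\<Prod>k\<in>{..<n} - ({j} \<union> E). Var k ^ exch_exp F j k)"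

definition hatF :: "nat \<Rightarrow> 'a::{factorial_semiring,idom,ring_char_0} seed \<Rightarrow> nat \<Rightarrow> 'a ratfun" where
  "hatF n S j = evalF (fst S) (snd S j) / evalF (fst S) (exch_den n (snd S) j {})"

definition laurent :: "nat \<Rightarrow> 'a::{factorial_semiring,idom,ring_char_0} ratfun \<Rightarrow> bool" where
  "laurent n L \<longleftrightarrow> (\<exists>p \<alpha>. in_vars n p \<and> Poly_Mapping.keys \<alpha> \<subseteq> {..<n} \<and> L = Fract p (monom1 \<alpha>))"

definition ldvd :: "nat \<Rightarrow> 'a::{factorial_semiring,idom,ring_char_0} mpoly \<Rightarrow> 'a ratfun \<Rightarrow> bool" where
  "ldvd n q L \<longleftrightarrow> (\<exists>r. laurent n r \<and> L = to_fr q * r)"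

text \<open>Non-monomial irreducible factor (monomials are units in the Laurent ring).\<close>
definition proper_factor :: "nat \<Rightarrow> 'a::{factorial_semiring,idom,ring_char_0} mpoly \<Rightarrow> bool" where
  "proper_factor n q \<longleftrightarrow> in_vars n q \<and> irreducible q \<and> (\<forall>j. \<not> q dvd Var j)"

text \<open>Formal (variable-level) computation of F'_i when x_k occurs in F_i, with the
  new variable x'_k represented by X_k and x'_j = x_j = X_j for j \<noteq> k.
  P_hat = hat F_k |_(x_i <- 0) = F_k|_(X_i<-0) / prod_(j\<noteq>k,i) X_j^(a_j);
  N_k = P_hat / X_k;  G_i = F_i |_(X_k <- N_k);  H_i = G_i with all common factors
  with P_hat removed;  F'_i = M H_i up to a unit, M a Laurent monomial not involving x'_i,
  F'_i a polynomial not divisible by any x'_j.\<close>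
definition new_exch_poly :: "nat \<Rightarrow> (nat \<Rightarrow> 'a::{factorial_semiring,idom,ring_char_0} mpoly) \<Rightarrow> nat \<Rightarrow> nat \<Rightarrow> 'a mpoly \<Rightarrow> bool" where
  "new_exch_poly n F k i F' \<longleftrightarrow>
     (let P = subst_mp (\<lambda>l. if l = i then 0 else Var l) (F k);
          Phat = to_fr P / to_fr (exch_den n F k {i});
          N = Phat / to_fr (Var k);
          G = eval_mp (\<lambda>c. to_fr (Const c)) (\<lambda>l. if l = k then N else to_fr (Var l)) (F i)
      in \<exists>D. D \<noteq> 0 \<and> in_vars n D \<and> ldvd n D G \<and>
             (\<forall>q. irreducible q \<longrightarrow> q dvd D \<longrightarrow> proper_factor n q \<and> q dvd P) \<and>
             \<not> (\<exists>q. proper_factor n q \<and> q dvd P \<and> ldvd n q (G / to_fr D)) \<and>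
             (\<exists>u \<alpha> \<beta>. is_unit u \<and> Poly_Mapping.keys \<alpha> \<subseteq> {..<n} - {i} \<and> Poly_Mapping.keys \<beta> \<subseteq> {..<n} - {i} \<and>
                 to_fr F' = to_fr (Const u) * to_fr (monom1 \<alpha>) / to_fr (monom1 \<beta>) * (G / to_fr D)) \<and>
             in_vars n F' \<and> (\<forall>j<n. \<not> Var j dvd F'))"

text \<open>S' is (a representative of) mu_k(S): the cluster is computed exactly, the
  exchange polynomials are determined up to unit factors of R.\<close>
definition LP_mutation :: "nat \<Rightarrow> nat \<Rightarrow> 'a::{factorial_semiring,idom,ring_char_0} seed \<Rightarrow> 'a seed \<Rightarrow> bool" where
  "LP_mutation n k S S' \<longleftrightarrow>
     (let x = fst S; F = snd S; x' = fst S'; F' = snd S' in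
       x' k = hatF n S k / x k \<and> (\<forall>i<n. i \<noteq> k \<longrightarrow> x' i = x i) \<and>
       (\<exists>u. is_unit u \<and> F' k = Const u * F k) \<and>
       (\<forall>i<n. i \<noteq> k \<longrightarrow>
          (k \<notin> vars (F i) \<longrightarrow> (\<exists>u. is_unit u \<and> F' i = Const u * F i)) \<and>
          (k \<in> vars (F i) \<longrightarrow> new_exch_poly n F k i (F' i))))"

text \<open>Vertices of T_n: reduced words in the labels 0..n-1 (no two equal adjacent
  letters), the root being []. The k-neighbour of t.\<close>
definition tree_vertex :: "nat \<Rightarrow> nat list \<Rightarrow> bool" where
  "tree_vertex n t \<longleftrightarrow> set t \<subseteq> {..<n} \<and> (\<forall>m. Suc m < length t \<longrightarrow> t ! m \<noteq> t ! Suc m)"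

definition tree_nbr :: "nat \<Rightarrow> nat list \<Rightarrow> nat list" where
  "tree_nbr k t = (if t \<noteq> [] \<and> last t = k then butlast t else t @ [k])"

definition LP_pattern :: "nat \<Rightarrow> (nat list \<Rightarrow> 'a::{factorial_semiring,idom,ring_char_0} seed) \<Rightarrow> bool" where
  "LP_pattern n \<Sigma> \<longleftrightarrow>
     (\<forall>t. tree_vertex n t \<longrightarrow> is_LP_seed n (\<Sigma> t)) \<and>
     (\<forall>t k. tree_vertex n t \<longrightarrow> k < n \<longrightarrow> LP_mutation n k (\<Sigma> t) (\<Sigma> (tree_nbr k t)))"

end

theory Submission
  imports Defs "HOL-Computational_Algebra.Polynomial"
begin

text \<open>
  Fix i and let F be the exchange polynomial of x_i in the first seed. On the field generated by
  the cluster, let w be the F-adic valuation in the coordinates x_l (l \<noteq> i) and x_i / F; it is the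
  divisor of zeros of F in the mutated coordinate system. Its centre stays visible in every seed of
  the pattern: either all cluster variables have value 0 and the valuation ring is a localisation
  of the polynomial ring in them, or exactly one x_k has positive value and the same holds once x_k
  is replaced by x_k / F_k, with F_k in the centre. The exponents in the exchange Laurent
  polynomials and the substitution of x_k by 0 in the mutation of the exchange polynomials are what
  makes this alternative invariant under mutation. As R[x_1, ..., x_n] is factorial, the centre on
  the polynomials without x_k is generated by F_k. Hence the exchange polynomial attached to x_i in
  a seed is determined, up to a unit, by w and the cluster.
\<close>

section \<open>Polynomials as polynomials in one variable\<close>

text \<open>Mutation in direction i gives x'_i = F / (m x_i) with m a monomial in the other
  variables, so x_i / F is, up to m, the inverse of x'_i. In these coordinates every coordinate is a
  unit along F = 0, whereas in the original cluster x_i and F vanish there together. The obstacle is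
  that exchange polynomials come from a formal recipe applied along a path, and two paths to the
  same cluster cannot be compared step by step. A valuation keeps no memory of the path, and the
  variable of positive value can be read off from the cluster alone. Positivity of F_k by itself
  would not suffice: if the centre had codimension two, F_k could lie in it without generating it.
  Requiring the valuation ring to be a localisation of the polynomial ring forces the centre to have
  height one, and in a factorial ring such a prime is principal. A cluster is only a transcendence
  basis, so the field carrying w may be a proper subfield of the ambient field; mutations merely
  change its generators.\<close>

lemma finite_vars [simp]: "finite (vars p)"
  by (simp add: vars_def)

lemma eval_mp_superset:
  assumes "finite A" "Poly_Mapping.keys p \<subseteq> A" "c 0 = 0"
  shows "eval_mp c v p =
    (\<Sum>\<alpha>\<in>A. c (Poly_Mapping.lookup p \<alpha>) * (\<Prod>j\<in>Poly_Mapping.keys \<alpha>. v j ^ Poly_Mapping.lookup \<alpha> j))"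
  unfolding eval_mp_def using assms
  by (intro sum.mono_neutral_left) (auto simp: in_keys_iff)

definition ring_hom :: "('a::comm_semiring_1 \<Rightarrow> 'b::comm_semiring_1) \<Rightarrow> bool" where
  "ring_hom h \<longleftrightarrow> h 0 = 0 \<and> h 1 = 1 \<and> (\<forall>a b. h (a + b) = h a + h b) \<and> (\<forall>a b. h (a * b) = h a * h b)"

lemma ring_homD:
  assumes "ring_hom h"
  shows "h 0 = 0" "h 1 = 1" "h (a + b) = h a + h b" "h (a * b) = h a * h b"
  using assms by (auto simp: ring_hom_def)

lemma ring_hom_power: "ring_hom h \<Longrightarrow> h (a ^ m) = h a ^ m"
  by (induction m) (auto simp: ring_homD[of h])

lemma ring_hom_sum: "ring_hom h \<Longrightarrow> h (sum f A) = (\<Sum>x\<in>A. h (f x))"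
  by (induction A rule: infinite_finite_induct) (auto simp: ring_homD[of h])

lemma ring_hom_prod: "ring_hom h \<Longrightarrow> h (prod f A) = (\<Prod>x\<in>A. h (f x))"
  by (induction A rule: infinite_finite_induct) (auto simp: ring_homD[of h])

lemma ring_hom_minus:
  fixes h :: "'a::comm_ring_1 \<Rightarrow> 'b::comm_ring_1"
  assumes "ring_hom h"
  shows "h (- a) = - h a" "h (a - b) = h a - h b"
proof -
  have *: "h (- a) = - h a" for a
    using ring_homD(3)[OF assms, of a "- a"] ring_homD(1)[OF assms]
    by (simp add: add_eq_0_iff)
  show "h (- a) = - h a" by (rule *)
  show "h (a - b) = h a - h b"
    using ring_homD(3)[OF assms, of a "- b"] * by simp
qed

lemma ring_hom_dvd: "ring_hom h \<Longrightarrow> a dvd b \<Longrightarrow> h a dvd h b"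
  by (auto simp: ring_homD[of h])

lemma monom_eval_add:
  "(\<Prod>j\<in>Poly_Mapping.keys (\<alpha> + \<beta>). v j ^ Poly_Mapping.lookup (\<alpha> + \<beta>) j) =
   (\<Prod>j\<in>Poly_Mapping.keys \<alpha>. v j ^ Poly_Mapping.lookup \<alpha> j) *
   (\<Prod>j\<in>Poly_Mapping.keys \<beta>. (v j :: 'b::comm_semiring_1) ^ Poly_Mapping.lookup \<beta> j)"
proof -
  let ?A = "Poly_Mapping.keys \<alpha> \<union> Poly_Mapping.keys \<beta>"
  have *: "(\<Prod>j\<in>Poly_Mapping.keys \<gamma>. v j ^ Poly_Mapping.lookup \<gamma> j) =
    (\<Prod>j\<in>?A. v j ^ Poly_Mapping.lookup \<gamma> j)" if "Poly_Mapping.keys \<gamma> \<subseteq> ?A" for \<gamma>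
    using that by (intro prod.mono_neutral_left) (auto simp: in_keys_iff)
  show ?thesis
    using *[of "\<alpha> + \<beta>"] *[of \<alpha>] *[of \<beta>] keys_add[of \<alpha> \<beta>]
    by (simp add: prod.distrib[symmetric] lookup_add power_add)
qed

lemma mpoly_sum_monomials:
  "p = (\<Sum>\<alpha>\<in>Poly_Mapping.keys p. Poly_Mapping.single \<alpha> (Poly_Mapping.lookup p \<alpha>))"
  by (rule poly_mapping_eqI)
    (simp add: lookup_sum lookup_single when_def in_keys_iff)

lemma eval_mp_single:
  "c 0 = 0 \<Longrightarrow> eval_mp c v (Poly_Mapping.single \<alpha> a) =
    c a * (\<Prod>j\<in>Poly_Mapping.keys \<alpha>. v j ^ Poly_Mapping.lookup \<alpha> j)"
  by (subst eval_mp_superset[where A = "{\<alpha>}"]) (auto split: if_splits)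

lemma eval_mp_add:
  assumes "ring_hom c"
  shows "eval_mp c v (p + q) = eval_mp c v p + eval_mp c v q"
proof -
  let ?A = "Poly_Mapping.keys p \<union> Poly_Mapping.keys q"
  note * = eval_mp_superset[where A = ?A and c = c, OF _ _ ring_homD(1)[OF assms]]
  show ?thesis
    using keys_add[of p q]
    by (simp add: * sum.distrib[symmetric] lookup_add ring_homD[OF assms] distrib_right)
qed

lemma eval_mp_zero [simp]: "eval_mp c v 0 = 0"
  by (simp add: eval_mp_def)

lemma eval_mp_sum:
  "ring_hom c \<Longrightarrow> eval_mp c v (sum f A) = (\<Sum>x\<in>A. eval_mp c v (f x))"
  by (induction A rule: infinite_finite_induct) (auto simp: eval_mp_add)

lemma eval_mp_mult:
  assumes "ring_hom c"
  shows "eval_mp c v (p * q) = eval_mp c v p * eval_mp c v q"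
proof -
  let ?s = "\<lambda>p \<alpha>. Poly_Mapping.single \<alpha> (Poly_Mapping.lookup p \<alpha>)"
  have "p * q = (\<Sum>\<alpha>\<in>Poly_Mapping.keys p. ?s p \<alpha>) * (\<Sum>\<beta>\<in>Poly_Mapping.keys q. ?s q \<beta>)"
    by (simp only: mpoly_sum_monomials[symmetric])
  also have "\<dots> = (\<Sum>\<alpha>\<in>Poly_Mapping.keys p. \<Sum>\<beta>\<in>Poly_Mapping.keys q. ?s p \<alpha> * ?s q \<beta>)"
    by (simp only: sum_product)
  finally have "eval_mp c v (p * q) =
    (\<Sum>\<alpha>\<in>Poly_Mapping.keys p. \<Sum>\<beta>\<in>Poly_Mapping.keys q. eval_mp c v (?s p \<alpha> * ?s q \<beta>))"
    by (simp only: eval_mp_sum[OF assms])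
  also have "\<dots> = (\<Sum>\<alpha>\<in>Poly_Mapping.keys p. \<Sum>\<beta>\<in>Poly_Mapping.keys q.
      eval_mp c v (?s p \<alpha>) * eval_mp c v (?s q \<beta>))"
    by (simp add: mult_single eval_mp_single ring_homD[OF assms] monom_eval_add mult_ac)
  also have "\<dots> = (\<Sum>\<alpha>\<in>Poly_Mapping.keys p. eval_mp c v (?s p \<alpha>)) *
      (\<Sum>\<beta>\<in>Poly_Mapping.keys q. eval_mp c v (?s q \<beta>))"
    by (simp only: sum_product)
  also have "\<dots> = eval_mp c v p * eval_mp c v q"
    by (simp only: eval_mp_sum[OF assms, symmetric] mpoly_sum_monomials[symmetric])
  finally show ?thesis .
qed

lemma eval_mp_Const: "ring_hom c \<Longrightarrow> eval_mp c v (Const a) = c a"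
  by (simp add: Const_def eval_mp_single ring_homD(1)[of c])

lemma eval_mp_Var: "ring_hom c \<Longrightarrow> eval_mp c v (Var j) = v j"
  by (simp add: Var_def eval_mp_single ring_homD(1,2)[of c])

lemma Const_one: "Const 1 = 1"
  by (simp add: Const_def)

lemma Const_zero: "Const 0 = 0"
  by (simp add: Const_def)

lemma ring_hom_eval_mp: "ring_hom c \<Longrightarrow> ring_hom (eval_mp c v)"
  using eval_mp_Const[of c v 1] ring_homD(2)[of c]
  by (simp add: ring_hom_def[of "eval_mp c v"] eval_mp_add eval_mp_mult Const_one)

lemma ring_hom_comp: "ring_hom f \<Longrightarrow> ring_hom g \<Longrightarrow> ring_hom (\<lambda>x. f (g x))"
  by (auto simp: ring_hom_def)

lemma ring_hom_Const: "ring_hom Const"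
  by (auto simp: ring_hom_def Const_def single_add mult_single)

lemma hom_eval_mp:
  assumes "ring_hom h"
  shows "h (eval_mp c v p) = eval_mp (\<lambda>a. h (c a)) (\<lambda>j. h (v j)) p"
  by (simp add: eval_mp_def ring_hom_sum[OF assms] ring_hom_prod[OF assms]
      ring_homD[OF assms] ring_hom_power[OF assms])

lemma eval_mp_cong:
  assumes "\<And>j. j \<in> vars p \<Longrightarrow> v j = v' j"
  shows "eval_mp c v p = eval_mp c v' p"
proof -
  have "(\<Prod>j\<in>Poly_Mapping.keys \<alpha>. v j ^ Poly_Mapping.lookup \<alpha> j) =
      (\<Prod>j\<in>Poly_Mapping.keys \<alpha>. v' j ^ Poly_Mapping.lookup \<alpha> j)" if "\<alpha> \<in> Poly_Mapping.keys p" for \<alpha>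
  proof (rule prod.cong[OF refl])
    fix j assume "j \<in> Poly_Mapping.keys \<alpha>"
    then have "j \<in> vars p" using that by (auto simp: vars_def)
    then show "v j ^ Poly_Mapping.lookup \<alpha> j = v' j ^ Poly_Mapping.lookup \<alpha> j"
      using assms by simp
  qed
  then show ?thesis unfolding eval_mp_def by (intro sum.cong refl) simp
qed

lemma Var_power: "Var j ^ m = Poly_Mapping.single (Poly_Mapping.single j m) 1"
  by (induction m) (auto simp: Var_def mult_single single_add[symmetric])

lemma monom_eq_prod:
  "(\<Prod>j\<in>Poly_Mapping.keys \<alpha>. Var j ^ Poly_Mapping.lookup \<alpha> j) = Poly_Mapping.single \<alpha> (1::'a::comm_semiring_1)"
proof -
  have "(\<Prod>j\<in>A. Var j ^ f j) =
      Poly_Mapping.single (\<Sum>j\<in>A. Poly_Mapping.single j (f j)) (1::'a)" for A f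
    by (induction A rule: infinite_finite_induct) (auto simp: Var_power mult_single)
  moreover have "(\<Sum>j\<in>Poly_Mapping.keys \<alpha>. Poly_Mapping.single j (Poly_Mapping.lookup \<alpha> j)) = \<alpha>"
    by (rule poly_mapping_eqI)
      (simp add: lookup_sum lookup_single when_def in_keys_iff)
  ultimately show ?thesis by simp
qed

lemma eval_mp_Const_Var: "eval_mp Const Var p = p"
proof -
  have "eval_mp Const Var p =
    (\<Sum>\<alpha>\<in>Poly_Mapping.keys p. Poly_Mapping.single \<alpha> (Poly_Mapping.lookup p \<alpha>))"
    unfolding eval_mp_def monom_eq_prod by (simp add: Const_def mult_single)
  then show ?thesis
    using mpoly_sum_monomials[of p] by simp
qed

lemma subst_mp_cong_Var:
  assumes "\<And>j. j \<in> vars p \<Longrightarrow> s j = Var j"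
  shows "subst_mp s p = p"
  unfolding subst_mp_def using eval_mp_cong[of p s Var Const] assms
  by (simp add: eval_mp_Const_Var)

lemma ring_hom_subst_mp: "ring_hom (subst_mp s)"
  unfolding subst_mp_def by (rule ring_hom_eval_mp[OF ring_hom_Const])

lemmas subst_mp_simps = ring_homD[OF ring_hom_subst_mp] ring_hom_power[OF ring_hom_subst_mp]

lemma subst_mp_Var [simp]: "subst_mp s (Var j) = s j"
  by (simp add: subst_mp_def eval_mp_Var ring_hom_Const)

lemma subst_mp_Const [simp]: "subst_mp s (Const a) = Const a"
  by (simp add: subst_mp_def eval_mp_Const ring_hom_Const)

lemma eval_mp_subst:
  "ring_hom c \<Longrightarrow> eval_mp c v (subst_mp s p) = eval_mp c (\<lambda>j. eval_mp c v (s j)) p"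
  unfolding subst_mp_def
  by (subst hom_eval_mp[OF ring_hom_eval_mp]) (auto simp: eval_mp_Const)

lemma subst_mp_subst: "subst_mp s (subst_mp s' p) = subst_mp (\<lambda>j. subst_mp s (s' j)) p"
  unfolding subst_mp_def[of s] subst_mp_def[of "\<lambda>j. eval_mp Const s (s' j)"]
  by (rule eval_mp_subst[OF ring_hom_Const])

section \<open>The variables occurring in a polynomial\<close>

lemma vars_zero [simp]: "vars 0 = {}"
  by (simp add: vars_def)

lemma vars_Const [simp]: "vars (Const a) = {}"
  by (auto simp: vars_def Const_def split: if_splits)

lemma vars_one [simp]: "vars 1 = {}"
  by (simp add: Const_one[symmetric])

lemma vars_Var: "vars (Var j :: 'a::zero_neq_one mpoly) = {j}"
  by (simp add: vars_def Var_def)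

lemma vars_add: "vars (p + q) \<subseteq> vars p \<union> vars q"
  using keys_add[of p q] by (auto simp: vars_def)

lemma vars_uminus [simp]: "vars (- p :: 'a::ab_group_add mpoly) = vars p"
  by (auto simp: vars_def in_keys_iff)

lemma vars_diff: "vars (p - q :: 'a::ab_group_add mpoly) \<subseteq> vars p \<union> vars q"
  using vars_add[of p "- q"] by simp

lemma vars_mult: "vars (p * q) \<subseteq> vars p \<union> vars q"
proof
  fix j assume "j \<in> vars (p * q)"
  then obtain \<gamma> where \<gamma>: "\<gamma> \<in> Poly_Mapping.keys (p * q)" "j \<in> Poly_Mapping.keys \<gamma>"
    by (auto simp: vars_def)
  then obtain \<alpha> \<beta> where *: "\<gamma> = \<alpha> + \<beta>" "\<alpha> \<in> Poly_Mapping.keys p" "\<beta> \<in> Poly_Mapping.keys q"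
    using keys_mult[of p q] by blast
  then show "j \<in> vars p \<union> vars q"
    using \<gamma>(2) keys_add[of \<alpha> \<beta>] by (auto simp: vars_def)
qed

lemma vars_power: "vars (p ^ m) \<subseteq> vars p"
  by (induction m) (use vars_mult in fastforce)+

lemma vars_sum: "(\<And>x. x \<in> A \<Longrightarrow> vars (f x) \<subseteq> B) \<Longrightarrow> vars (sum f A) \<subseteq> B"
proof (induction A rule: infinite_finite_induct)
  case (insert x F)
  then show ?case using vars_add[of "f x" "sum f F"] by (simp add: subset_iff) blast
qed auto

lemma vars_prod: "(\<And>x. x \<in> A \<Longrightarrow> vars (f x) \<subseteq> B) \<Longrightarrow> vars (prod f A) \<subseteq> B"
proof (induction A rule: infinite_finite_induct)
  case (insert x F)
  then show ?case using vars_mult[of "f x" "prod f F"] by (simp add: subset_iff) blast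
qed auto

lemma vars_subst_mp:
  fixes s :: "nat \<Rightarrow> 'a::comm_semiring_1 mpoly"
  assumes "\<And>j. j \<in> vars p \<Longrightarrow> vars (s j) \<subseteq> B"
  shows "vars (subst_mp s p) \<subseteq> B"
proof -
  have "vars (Const a * (\<Prod>j\<in>Poly_Mapping.keys \<alpha>. s j ^ Poly_Mapping.lookup \<alpha> j)) \<subseteq> B"
    if "\<alpha> \<in> Poly_Mapping.keys p" for \<alpha> a
  proof -
    have "vars (\<Prod>j\<in>Poly_Mapping.keys \<alpha>. s j ^ Poly_Mapping.lookup \<alpha> j) \<subseteq> B"
    proof (rule vars_prod)
      fix j assume "j \<in> Poly_Mapping.keys \<alpha>"
      then have "vars (s j) \<subseteq> B" using assms that by (auto simp: vars_def)
      then show "vars (s j ^ Poly_Mapping.lookup \<alpha> j) \<subseteq> B"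
        using vars_power[of "s j"] by blast
    qed
    then show ?thesis
      using vars_mult[of "Const a"] by fastforce
  qed
  then show ?thesis
    unfolding subst_mp_def eval_mp_def by (intro vars_sum) auto
qed

lemma Const_inj [simp]: "Const a = Const b \<longleftrightarrow> a = b"
  by (auto simp: Const_def dest: inj_single[THEN injD])

lemma vars_empty_imp_Const:
  assumes "vars p = {}"
  shows "p = Const (Poly_Mapping.lookup p 0)"
proof (rule poly_mapping_eqI)
  fix \<alpha>
  have "\<alpha> = 0" if "\<alpha> \<in> Poly_Mapping.keys p" for \<alpha>
    using assms that by (auto simp: vars_def)
  then show "Poly_Mapping.lookup p \<alpha> = Poly_Mapping.lookup (Const (Poly_Mapping.lookup p 0)) \<alpha>"
    by (cases "\<alpha> = 0") (auto simp: Const_def lookup_single when_def in_keys_iff)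
qed

text \<open>The coefficients stay in the type of all polynomials and merely avoid X_k
  (\<open>vars_coeff_upoly\<close>). As an instance of \<open>eval_mp\<close> the map is a ring
  homomorphism at once, which makes degree and leading coefficient of univariate polynomials over a
  domain available for X_k.\<close>

definition upoly :: "nat \<Rightarrow> 'a::idom mpoly \<Rightarrow> 'a mpoly poly" where
  "upoly k = eval_mp (\<lambda>c. [:Const c:]) (\<lambda>l. if l = k then [:0, 1:] else [:Var l:])"

lemma ring_hom_const_poly: "ring_hom (\<lambda>c::'b::comm_semiring_1. [:c:])"
  by (auto simp: ring_hom_def one_pCons mult.commute)

lemma ring_hom_upoly: "ring_hom (upoly k)"
  unfolding upoly_def
  by (rule ring_hom_eval_mp[OF ring_hom_comp[OF ring_hom_const_poly ring_hom_Const]])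

lemmas upoly_simps = ring_homD[OF ring_hom_upoly] ring_hom_power[OF ring_hom_upoly]
  ring_hom_minus[OF ring_hom_upoly]

lemma ring_hom_poly: "ring_hom (\<lambda>p. poly p (a::'b::comm_semiring_1))"
  by (auto simp: ring_hom_def)

lemma poly_upoly [simp]: "poly (upoly k p) (Var k) = p"
proof -
  have "poly (upoly k p) (Var k) =
    eval_mp (\<lambda>a. poly [:Const a:] (Var k)) (\<lambda>j. poly (if j = k then [:0, 1:] else [:Var j:]) (Var k)) p"
    unfolding upoly_def by (rule hom_eval_mp[OF ring_hom_poly])
  also have "\<dots> = eval_mp Const Var p"
    by (rule arg_cong2[where f = "\<lambda>c v. eval_mp c v p"]) auto
  finally show ?thesis by (simp add: eval_mp_Const_Var)
qed

lemma upoly_notin_vars: "k \<notin> vars p \<Longrightarrow> upoly k p = [:p:]"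
proof -
  assume "k \<notin> vars p"
  then have "upoly k p = eval_mp (\<lambda>c. [:Const c:]) (\<lambda>l. [:Var l:]) p"
    unfolding upoly_def by (intro eval_mp_cong) auto
  also have "\<dots> = [:eval_mp Const Var p:]"
    by (rule hom_eval_mp[OF ring_hom_const_poly, symmetric])
  finally show ?thesis by (simp add: eval_mp_Const_Var)
qed

lemma upoly_Var [simp]: "upoly k (Var k) = [:0, 1:]"
  unfolding upoly_def
  by (simp add: eval_mp_Var ring_hom_comp[OF ring_hom_const_poly ring_hom_Const])

lemma vars_coeff_upoly: "vars (coeff (upoly k p) i) \<subseteq> vars p - {k}"
proof -
  \<comment> \<open>The polynomials satisfying \<open>S\<close> form a subring that contains the
    images of all constants and variables from which \<open>upoly k p\<close> is built.\<close>
  define S where "S P \<longleftrightarrow> (\<forall>i. vars (coeff P i) \<subseteq> vars p - {k})" for P :: "'a mpoly poly"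
  have mult: "S (P * Q)" if "S P" "S Q" for P Q
    unfolding S_def coeff_mult
  proof (intro allI vars_sum)
    fix i j
    show "vars (coeff P j * coeff Q (i - j)) \<subseteq> vars p - {k}"
      using that vars_mult[of "coeff P j" "coeff Q (i - j)"] unfolding S_def by blast
  qed
  have const: "S [:a:]" if "vars a \<subseteq> vars p - {k}" for a
    using that by (auto simp: S_def coeff_pCons split: nat.split)
  have one: "S 1" unfolding one_pCons by (rule const) simp
  have X: "S [:0, 1:]"
    by (auto simp: S_def coeff_pCons split: nat.split)
  have power: "S (P ^ m)" if "S P" for P m
    by (induction m) (simp_all add: that mult one)
  have prod: "S (prod f A)" if "\<And>x. x \<in> A \<Longrightarrow> S (f x)" for A and f :: "nat \<Rightarrow> 'a mpoly poly"
    using that by (induction A rule: infinite_finite_induct) (simp_all add: one mult)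
  have sum: "S (sum f A)" if "\<And>x. x \<in> A \<Longrightarrow> S (f x)"
    for A and f :: "(nat \<Rightarrow>\<^sub>0 nat) \<Rightarrow> 'a mpoly poly"
    using that unfolding S_def coeff_sum by (intro allI vars_sum) simp
  have "S (upoly k p)"
    unfolding upoly_def eval_mp_def
  proof (intro sum mult prod power)
    show "S [:Const a:]" for a by (rule const) simp
    fix \<alpha> j assume "\<alpha> \<in> Poly_Mapping.keys p" "j \<in> Poly_Mapping.keys \<alpha>"
    then have "j \<in> vars p" by (auto simp: vars_def)
    then show "S (if j = k then [:0, 1:] else [:Var j:])"
      by (auto simp: vars_Var intro: X const)
  qed
  then show ?thesis by (simp add: S_def)
qed

lemma upoly_poly:
  assumes "\<And>i. k \<notin> vars (coeff P i)"
  shows "upoly k (poly P (Var k)) = P"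
proof -
  have "upoly k (poly P (Var k)) = (\<Sum>i\<le>degree P. [:coeff P i:] * [:0, 1:] ^ i)"
    by (simp add: poly_altdef ring_hom_sum[OF ring_hom_upoly] upoly_simps upoly_notin_vars assms
        del: mult_pCons_left)
  also have "\<dots> = (\<Sum>i\<le>degree P. Polynomial.monom (coeff P i) i)"
    by (simp add: monom_altdef del: mult_pCons_left) simp
  also have "\<dots> = P" by (rule poly_as_sum_of_monoms)
  finally show ?thesis .
qed

lemma upoly_eq_0_iff [simp]: "upoly k p = 0 \<longleftrightarrow> p = 0"
proof
  assume "upoly k p = 0"
  then show "p = 0" using poly_upoly[of k p] by simp
qed (simp add: upoly_simps)

lemma vars_iff_degree: "k \<in> vars p \<longleftrightarrow> Polynomial.degree (upoly k p) > 0"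
proof
  assume "k \<in> vars p"
  show "Polynomial.degree (upoly k p) > 0"
  proof (rule ccontr)
    assume "\<not> ?thesis"
    then obtain a where a: "upoly k p = [:a:]" by (meson degree_eq_zeroE gr0I)
    then have "p = a" using poly_upoly[of k p] by simp
    then show False using vars_coeff_upoly[of k p 0] a \<open>k \<in> vars p\<close> by auto
  qed
next
  assume "Polynomial.degree (upoly k p) > 0"
  then show "k \<in> vars p" using upoly_notin_vars[of k p] by fastforce
qed

text \<open>Over a domain the degrees in X_k add, and X_k occurs exactly when its degree is
  positive; so no variable cancels out of a nonzero product.\<close>

lemma vars_mult_eq:
  fixes p q :: "'a::idom mpoly"
  assumes "p * q \<noteq> 0"
  shows "vars (p * q) = vars p \<union> vars q"
proof -
  have "p \<noteq> 0" "q \<noteq> 0" using assms by auto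
  then show ?thesis
    by (auto simp: vars_iff_degree upoly_simps degree_mult_eq)
qed

lemma vars_dvd: "p dvd q \<Longrightarrow> q \<noteq> 0 \<Longrightarrow> vars p \<subseteq> vars (q :: 'a::idom mpoly)"
  by (auto simp: vars_mult_eq elim!: dvdE)

lemma is_unit_mpoly:
  assumes "p dvd (1 :: 'a::idom mpoly)"
  obtains u where "u dvd 1" "p = Const u"
proof -
  obtain q where q: "p * q = 1" using assms by (metis dvdE)
  then have "vars p = {}" "vars q = {}" using vars_mult_eq[of p q] by auto
  then obtain a b where ab: "p = Const a" "q = Const b" using vars_empty_imp_Const by blast
  then have "Const (a * b) = Const 1" using q ring_homD(4)[OF ring_hom_Const, of a b] by (simp add: Const_one)
  then have "a dvd 1" by (metis Const_inj dvd_triv_left)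
  then show ?thesis using ab that by blast
qed

lemma is_unit_Const: "u dvd 1 \<Longrightarrow> Const u dvd 1"
  using ring_hom_dvd[OF ring_hom_Const, of u 1] by (simp add: Const_one)

lemma Var_dvd_diff_subst_zero:
  "Var k dvd p - subst_mp (\<lambda>l. if l = k then 0 else Var l) (p :: 'a::idom mpoly)"
proof -
  let ?s = "subst_mp (\<lambda>l. if l = k then 0 else Var l :: 'a mpoly)"
  obtain a Q where aQ: "upoly k p = pCons a Q" by (cases "upoly k p") auto
  then have p: "p = a + Var k * poly Q (Var k)"
    using poly_upoly[of k p] by simp
  have "k \<notin> vars a" using vars_coeff_upoly[of k p 0] aQ by auto
  then have "?s a = a" by (intro subst_mp_cong_Var) auto
  then have "?s p = a" by (subst p) (simp add: subst_mp_simps)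
  then have "p - ?s p = Var k * poly Q (Var k)" by (subst p) simp
  then show ?thesis by simp
qed

lemma notin_vars_subst_zero:
  "k \<notin> vars (subst_mp (\<lambda>l. if l = k then 0 else Var l) (p :: 'a::idom mpoly))"
  using vars_subst_mp[of p "\<lambda>l. if l = k then 0 else Var l" "- {k}"] by (auto simp: vars_Var)

section \<open>Factoriality of the polynomial ring\<close>

lemma in_vars_mono: "in_vars m p \<Longrightarrow> m \<le> m' \<Longrightarrow> in_vars m' p"
  by (auto simp: in_vars_def)

lemma in_vars_simps [simp]: "in_vars m 0" "in_vars m 1" "in_vars m (Const a)"
  by (auto simp: in_vars_def)

lemma in_vars_Var: "l < m \<Longrightarrow> in_vars m (Var l :: 'a::zero_neq_one mpoly)"
  by (simp add: in_vars_def vars_Var)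

lemma in_vars_add: "in_vars m p \<Longrightarrow> in_vars m q \<Longrightarrow> in_vars m (p + q)"
  using vars_add[of p q] by (auto simp: in_vars_def)

lemma in_vars_diff: "in_vars m p \<Longrightarrow> in_vars m q \<Longrightarrow> in_vars m (p - q :: 'a::ab_group_add mpoly)"
  using vars_diff[of p q] by (auto simp: in_vars_def)

lemma in_vars_mult: "in_vars m p \<Longrightarrow> in_vars m q \<Longrightarrow> in_vars m (p * q)"
  using vars_mult[of p q] by (auto simp: in_vars_def)

lemma in_vars_power: "in_vars m p \<Longrightarrow> in_vars m (p ^ e)"
  using vars_power[of p e] by (auto simp: in_vars_def)

lemma in_vars_dvd: "p dvd q \<Longrightarrow> q \<noteq> 0 \<Longrightarrow> in_vars m q \<Longrightarrow> in_vars m (p :: 'a::idom mpoly)"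
  using vars_dvd[of p q] by (auto simp: in_vars_def)

lemma in_vars_exists: "\<exists>m. in_vars m p"
proof (cases "vars p = {}")
  case False
  then have "in_vars (Suc (Max (vars p))) p"
    by (auto simp: in_vars_def less_Suc_eq_le)
  then show ?thesis ..
qed (simp add: in_vars_def)

definition degv :: "nat \<Rightarrow> 'a::idom mpoly \<Rightarrow> nat" where
  "degv m p = Polynomial.degree (upoly m p)"

definition lcv :: "nat \<Rightarrow> 'a::idom mpoly \<Rightarrow> 'a mpoly" where
  "lcv m p = lead_coeff (upoly m p)"

lemma lcv_eq_0_iff [simp]: "lcv m p = 0 \<longleftrightarrow> p = 0"
  by (simp add: lcv_def)

lemma in_vars_lcv: "in_vars (Suc m) p \<Longrightarrow> in_vars m (lcv m p)"
  using vars_coeff_upoly[of m p] unfolding in_vars_def lcv_def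
  by (fastforce simp: less_Suc_eq)

lemma degv_mult: "p \<noteq> 0 \<Longrightarrow> q \<noteq> 0 \<Longrightarrow> degv m (p * q) = degv m p + degv m q"
  by (simp add: degv_def upoly_simps degree_mult_eq)

lemma lcv_mult: "lcv m (p * q) = lcv m p * lcv m q"
  by (simp add: lcv_def upoly_simps lead_coeff_mult)

lemma in_vars_degv_lcv:
  assumes "in_vars m p"
  shows "degv m p = 0" "lcv m p = p"
proof -
  have "m \<notin> vars p" using assms by (auto simp: in_vars_def)
  then show "degv m p = 0" "lcv m p = p"
    by (simp_all add: degv_def lcv_def upoly_notin_vars)
qed

lemma degv_eq_0_imp_in_vars: "in_vars (Suc m) p \<Longrightarrow> degv m p = 0 \<Longrightarrow> in_vars m p"
  using vars_iff_degree[of m p] by (auto simp: in_vars_def degv_def less_Suc_eq)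

lemma degv_Var_power: "degv m (Var m ^ e) = e"
  by (simp add: degv_def upoly_simps degree_power_eq)

lemma lcv_Var_power: "lcv m (Var m ^ e) = 1"
  by (simp add: lcv_def upoly_simps lead_coeff_power)

lemma Var_neq_0 [simp]: "Var m \<noteq> (0 :: 'a::zero_neq_one mpoly)"
  using vars_Var[of m, where 'a = 'a] by force

lemma degv_diff_less:
  assumes "degv m p = degv m q" "lcv m p = lcv m q"
  shows "p = q \<or> degv m (p - q) < degv m p"
proof (cases "p = q")
  case False
  let ?d = "degv m p"
  have le: "Polynomial.degree (upoly m (p - q)) \<le> ?d"
    using assms(1) by (simp add: degv_def upoly_simps degree_diff_le)
  have "coeff (upoly m (p - q)) ?d = 0"
    using assms by (simp add: degv_def lcv_def upoly_simps)
  then have "Polynomial.degree (upoly m (p - q)) \<noteq> ?d"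
    using False by (metis eq_iff_diff_eq_0 leading_coeff_0_iff upoly_eq_0_iff)
  with le show ?thesis by (simp add: degv_def)
qed simp

text \<open>Iterated leading coefficients end in R. The degrees met on the way plus the number of
  prime factors of the last coefficient form a measure that is additive on products and vanishes
  only on units. R need not be Noetherian; this measure makes the descent to proper divisors
  well-founded.\<close>

fun msize :: "nat \<Rightarrow> 'a::{factorial_semiring,idom} mpoly \<Rightarrow> nat" where
  "msize 0 p = size (prime_factorization (Poly_Mapping.lookup p 0))"
| "msize (Suc m) p = degv m p + msize m (lcv m p)"

lemma in_vars_0_Const: "in_vars 0 p \<Longrightarrow> \<exists>a. p = Const a"
  using vars_empty_imp_Const[of p] by (auto simp: in_vars_def)

lemma lookup_Const_0 [simp]: "Poly_Mapping.lookup (Const a) 0 = a"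
  by (simp add: Const_def)

lemma Const_mult: "Const (a * b :: 'a::comm_semiring_1) = Const a * Const b"
  by (rule ring_homD(4)[OF ring_hom_Const])

lemma Const_eq_0_iff [simp]: "Const a = 0 \<longleftrightarrow> a = 0"
  by (metis Const_inj Const_zero)

lemma msize_mult:
  "in_vars m p \<Longrightarrow> in_vars m q \<Longrightarrow> p \<noteq> 0 \<Longrightarrow> q \<noteq> 0 \<Longrightarrow> msize m (p * q) = msize m p + msize m q"
proof (induction m arbitrary: p q)
  case 0
  then obtain a b where "p = Const a" "q = Const b" using in_vars_0_Const by blast
  with 0 show ?case by (simp add: Const_mult[symmetric] prime_factorization_mult)
next
  case (Suc m)
  then show ?case by (simp add: degv_mult lcv_mult in_vars_lcv)
qed

lemma msize_eq_0_imp_unit: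
  "in_vars m p \<Longrightarrow> p \<noteq> 0 \<Longrightarrow> msize m p = 0 \<Longrightarrow> p dvd 1"
proof (induction m arbitrary: p)
  case 0
  then obtain a where "p = Const a" using in_vars_0_Const by blast
  with 0 show ?case by (simp add: prime_factorization_empty_iff is_unit_Const)
next
  case (Suc m)
  then have "in_vars m p" using degv_eq_0_imp_in_vars[of m p] by simp
  with Suc show ?case by (simp add: in_vars_degv_lcv)
qed

lemma irreducible_divisor_exists:
  fixes p :: "'a::{factorial_semiring,idom} mpoly"
  assumes "p \<noteq> 0" "\<not> p dvd 1"
  shows "\<exists>q. irreducible q \<and> q dvd p"
proof -
  obtain m where "in_vars m p" using in_vars_exists by blast
  with assms show ?thesis
  proof (induction "msize m p" arbitrary: p rule: less_induct)
    case less
    show ?case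
    proof (cases "irreducible p")
      case False
      then obtain a b where ab: "p = a * b" "\<not> a dvd 1" "\<not> b dvd 1"
        using less.prems by (auto simp: irreducible_def)
      then have ne: "a \<noteq> 0" "b \<noteq> 0" using less.prems by auto
      have v: "in_vars m a" "in_vars m b"
        using ab(1) less.prems in_vars_dvd[of a p m] in_vars_dvd[of b p m] by auto
      then have "msize m p = msize m a + msize m b" using ne ab by (simp add: msize_mult)
      moreover have "msize m b \<noteq> 0" using msize_eq_0_imp_unit v ne ab by blast
      ultimately have "\<exists>q. irreducible q \<and> q dvd a"
        using less.hyps[of a] ne ab v by simp
      then show ?thesis using ab(1) by auto
    qed auto
  qed
qed

text \<open>Allows a coefficient to be cancelled or distributed one irreducible factor at a time. It
  rests on the existence of factorisations only, since it serves on the way to primality.\<close>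

lemma mpoly_factor_induct [consumes 1, case_names unit factor]:
  fixes c :: "'a::{factorial_semiring,idom} mpoly"
  assumes "c \<noteq> 0"
    and unit: "\<And>u. u dvd 1 \<Longrightarrow> P u"
    and factor: "\<And>q c. irreducible q \<Longrightarrow> c \<noteq> 0 \<Longrightarrow> P c \<Longrightarrow> P (q * c)"
  shows "P c"
proof -
  obtain m where "in_vars m c" using in_vars_exists by blast
  with assms(1) show ?thesis
  proof (induction "msize m c" arbitrary: c rule: less_induct)
    case less
    show ?case
    proof (cases "c dvd 1")
      case False
      then obtain q c' where q: "irreducible q" "c = q * c'"
        using irreducible_divisor_exists less.prems by (metis dvdE)
      then have ne: "q \<noteq> 0" "c' \<noteq> 0" using less.prems by auto
      have v: "in_vars m q" "in_vars m c'"
        using q(2) less.prems in_vars_dvd[of q c m] in_vars_dvd[of c' c m] by auto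
      have "msize m c = msize m q + msize m c'" using ne q v by (simp add: msize_mult)
      moreover have "msize m q \<noteq> 0"
        using msize_eq_0_imp_unit v ne q by (auto simp: irreducible_def)
      ultimately show ?thesis using less.hyps[of c'] ne v q factor by simp
    qed (rule unit)
  qed
qed

text \<open>If q divides f * g, it divides the product of the leading coefficients, hence one of
  them, say that of f; subtracting the leading term of f keeps the divisibility and lowers the
  degree. Thus a prime free of the new variable remains prime.\<close>

lemma prime_coefficients_imp_prime:
  fixes q :: "'a::idom mpoly"
  assumes q: "in_vars m q"
    and prime: "\<And>f g. in_vars m f \<Longrightarrow> in_vars m g \<Longrightarrow> q dvd f * g \<Longrightarrow> q dvd f \<or> q dvd g"
    and fg: "in_vars (Suc m) f" "in_vars (Suc m) g" "q dvd f * g"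
  shows "q dvd f \<or> q dvd g"
  using fg
proof (induction "degv m f + degv m g" arbitrary: f g rule: less_induct)
  case less
  show ?case
  proof (cases "f = 0 \<or> g = 0")
    case False
    have lc: "q dvd lcv m f * lcv m g"
    proof -
      obtain s where "f * g = q * s" using less.prems(3) by (elim dvdE)
      then have "lcv m f * lcv m g = q * lcv m s"
        using lcv_mult[of m f g] lcv_mult[of m q s] in_vars_degv_lcv(2)[OF q] by simp
      then show ?thesis by simp
    qed
    \<comment> \<open>Stated for arbitrary f and g so that it also serves with the two factors
      exchanged.\<close>
    have step: "q dvd f \<or> q dvd g"
      if fg: "in_vars (Suc m) f" "in_vars (Suc m) g" "q dvd f * g" "f \<noteq> 0" "q dvd lcv m f"
        and IH: "\<And>f'. degv m f' < degv m f \<Longrightarrow> in_vars (Suc m) f' \<Longrightarrow> q dvd f' * g \<Longrightarrow> q dvd f' \<or> q dvd g"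
      for f g
    proof -
      define t where "t = lcv m f * Var m ^ degv m f"
      have t: "degv m t = degv m f" "lcv m t = lcv m f" "q dvd t" "in_vars (Suc m) t"
        using fg in_vars_degv_lcv[OF in_vars_lcv[OF fg(1)]]
        by (auto simp: t_def degv_mult lcv_mult degv_Var_power lcv_Var_power
            intro!: in_vars_mult in_vars_power in_vars_Var in_vars_mono[OF in_vars_lcv])
      have "f = t \<or> degv m (f - t) < degv m f" using t by (intro degv_diff_less) simp_all
      moreover have "q dvd (f - t) * g"
        using fg(3) t(3) by (simp add: left_diff_distrib)
      ultimately have "q dvd f - t \<or> q dvd g"
        using IH[of "f - t"] fg t by (auto intro: in_vars_diff)
      then show ?thesis using t(3) by (metis diff_add_cancel dvd_add)
    qed
    from prime[OF in_vars_lcv in_vars_lcv lc] less.prems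
    have "q dvd lcv m f \<or> q dvd lcv m g" by blast
    then show ?thesis
    proof
      assume lcf: "q dvd lcv m f"
      show ?thesis
      proof (rule step)
        fix f' assume "degv m f' < degv m f" "in_vars (Suc m) f'" "q dvd f' * g"
        then show "q dvd f' \<or> q dvd g"
          using less.hyps[of f' g] less.prems by auto
      qed (use less.prems False lcf in simp_all)
    next
      assume lcg: "q dvd lcv m g"
      have "q dvd g \<or> q dvd f"
      proof (rule step)
        fix g' assume "degv m g' < degv m g" "in_vars (Suc m) g'" "q dvd g' * f"
        then show "q dvd g' \<or> q dvd f"
          using less.hyps[of f g'] less.prems by (auto simp: mult.commute[of g'])
      qed (use less.prems False lcg in \<open>simp_all add: mult.commute[of g]\<close>)
      then show ?thesis by blast
    qed
  qed auto
qed

text \<open>Division with remainder in X_m becomes possible after multiplying by powers of the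
  leading coefficient of h. What matters later is that the multiplier c is free of X_m.\<close>

lemma pseudo_division:
  fixes f h :: "'a::idom mpoly"
  assumes h: "h \<noteq> 0" "in_vars (Suc m) h" and f: "in_vars (Suc m) f"
  shows "\<exists>c Q r. in_vars m c \<and> c \<noteq> 0 \<and> in_vars (Suc m) Q \<and> in_vars (Suc m) r \<and>
    c * f = Q * h + r \<and> (r = 0 \<or> degv m r < degv m h)"
  using f
proof (induction "degv m f" arbitrary: f rule: less_induct)
  case less
  show ?case
  proof (cases "f = 0 \<or> degv m f < degv m h")
    case True
    then show ?thesis
      using less.prems by (intro exI[of _ 1] exI[of _ 0] exI[of _ f]) auto
  next
    case False
    define a where "a = lcv m h"
    define t where "t = lcv m f * Var m ^ (degv m f - degv m h)"
    have a: "in_vars m a" "a \<noteq> 0" "in_vars (Suc m) a"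
      using h by (auto simp: a_def in_vars_lcv in_vars_mono[OF in_vars_lcv])
    have lf: "in_vars m (lcv m f)" using less.prems by (rule in_vars_lcv)
    have t: "in_vars (Suc m) t"
      by (auto simp: t_def intro!: in_vars_mult in_vars_power in_vars_Var in_vars_mono[OF lf])
    have deg: "degv m (a * f) = degv m f" "degv m (t * h) = degv m f"
      using False a h in_vars_degv_lcv[OF a(1)] in_vars_degv_lcv[OF lf]
      by (auto simp: t_def degv_mult degv_Var_power)
    moreover have "lcv m (a * f) = lcv m (t * h)"
      using in_vars_degv_lcv[OF a(1)] in_vars_degv_lcv[OF lf]
      by (simp add: t_def lcv_mult lcv_Var_power a_def mult.commute)
    ultimately have red: "a * f = t * h \<or> degv m (a * f - t * h) < degv m f"
      using degv_diff_less[of m "a * f" "t * h"] by simp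
    have v: "in_vars (Suc m) (a * f - t * h)"
      using a t h less.prems by (intro in_vars_diff in_vars_mult)
    from red show ?thesis
    proof
      assume "a * f = t * h"
      then show ?thesis using a t by (intro exI[of _ a] exI[of _ t] exI[of _ 0]) simp
    next
      assume "degv m (a * f - t * h) < degv m f"
      from less.hyps[OF this v] obtain c Q r where IH: "in_vars m c" "c \<noteq> 0"
        "in_vars (Suc m) Q" "in_vars (Suc m) r" "c * (a * f - t * h) = Q * h + r"
        "r = 0 \<or> degv m r < degv m h"
        by blast
      have "(c * a) * f = (Q + c * t) * h + r"
        using IH(5) by (simp add: algebra_simps)
      moreover have "in_vars (Suc m) (Q + c * t)"
        using IH t by (intro in_vars_add in_vars_mult) (auto intro: in_vars_mono)
      ultimately show ?thesis using IH a
        by (intro exI[of _ "c * a"] exI[of _ "Q + c * t"] exI[of _ r]) (auto intro: in_vars_mult)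
    qed
  qed
qed

lemma irreducible_dvd_irreducible:
  fixes p q :: "'a::idom mpoly"
  assumes "irreducible p" "irreducible q" "q dvd p"
  shows "vars p = vars q"
proof -
  obtain s where s: "p = q * s" using assms by (elim dvdE)
  then have "s dvd 1" using assms by (auto simp: irreducible_def)
  then have "vars s = {}" by (elim is_unit_mpoly) simp
  moreover have "vars p = vars q \<union> vars s" using s assms by (metis irreducible_def vars_mult_eq)
  ultimately show ?thesis by simp
qed

text \<open>Gauss's lemma without fractions or contents. In the new variable, let h have least degree among
  the nonzero polynomials with p dvd h * g. Pseudo-division of p and f by h leaves no remainder,
  and the coefficients by which one has to multiply can be cancelled since their irreducible
  factors are prime.\<close>

lemma irreducible_imp_prime_in_vars:
  fixes p :: "'a::{factorial_semiring,idom} mpoly"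
  assumes "irreducible p" "in_vars m p" "in_vars m f" "in_vars m g" "p dvd f * g"
  shows "p dvd f \<or> p dvd g"
  using assms
proof (induction m arbitrary: p f g)
  case 0
  then obtain a b c where abc: "p = Const a" "f = Const b" "g = Const c"
    using in_vars_0_Const by metis
  have Const_dvd: "Const x dvd Const y \<longleftrightarrow> x dvd y" for x y :: 'a
  proof
    assume "Const x dvd Const y"
    then obtain r where r: "Const y = Const x * r" by (elim dvdE)
    have "Poly_Mapping.lookup (Const x * r) 0 = x * Poly_Mapping.lookup r 0"
      by (simp add: Const_def mult_map_scale_conv_mult[symmetric] Poly_Mapping.map.rep_eq when_def)
    then show "x dvd y" using r by (metis dvd_triv_left lookup_Const_0)
  qed (rule ring_hom_dvd[OF ring_hom_Const])
  have "irreducible a"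
    unfolding irreducible_def
  proof (intro conjI allI impI)
    show "a \<noteq> 0" "\<not> a dvd 1" using 0 abc Const_dvd[of a 1] by (auto simp: irreducible_def Const_one)
    fix x y assume "a = x * y"
    then have "p = Const x * Const y" using abc by (simp add: Const_mult)
    then show "x dvd 1 \<or> y dvd 1"
      using 0 Const_dvd[of _ 1] by (metis Const_one irreducible_def)
  qed
  then have "prime_elem a" by (rule irreducible_imp_prime_elem)
  moreover have "a dvd b * c" using 0 abc by (simp add: Const_dvd Const_mult[symmetric])
  ultimately show ?case using abc by (simp add: Const_dvd prime_elem_dvd_mult_iff)
next
  case (Suc m)
  \<comment> \<open>Irreducible polynomials free of X_m are prime by the induction hypothesis, so
    only a p that involves X_m needs the argument below.\<close>
  have prime: "q dvd f \<or> q dvd g"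
    if "irreducible q" "in_vars m q" "in_vars (Suc m) f" "in_vars (Suc m) g" "q dvd f * g"
    for q f g :: "'a mpoly"
    using prime_coefficients_imp_prime[OF that(2) _ that(3-5)] Suc.IH that(1,2) by blast
  show ?case
  proof (cases "in_vars m p")
    case True
    then show ?thesis using prime Suc.prems by blast
  next
    case False
    have p: "irreducible p" "p \<noteq> 0" "in_vars (Suc m) p" using Suc.prems by (auto simp: irreducible_def)
    have cancel: "p dvd f"
      if "c \<noteq> 0" "in_vars m c" "in_vars (Suc m) f" "p dvd c * f" for c f
      using that
    proof (induction c rule: mpoly_factor_induct)
      case (unit u)
      then obtain u' where u': "1 = u * u'" by (elim dvdE)
      have "p dvd u' * (u * f)" using unit by simp
      also have "u' * (u * f) = (u * u') * f" by (simp only: mult_ac)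
      also have "\<dots> = f" by (simp add: u'[symmetric])
      finally show ?case .
    next
      case (factor q c)
      have v: "in_vars m q" "in_vars m c"
        using factor in_vars_dvd[of _ "q * c" m] by (auto simp: irreducible_def)
      obtain s where s: "q * c * f = p * s" using factor.prems by (elim dvdE)
      show ?case
      proof (cases "f = 0")
        case False
        then have "q * c * f \<noteq> 0" using factor by (auto simp: irreducible_def)
        moreover have "in_vars (Suc m) (q * c * f)"
          using factor v by (intro in_vars_mult) (auto intro: in_vars_mono)
        ultimately have "in_vars (Suc m) s"
          by (intro in_vars_dvd[of s "q * c * f" "Suc m"]) (simp_all add: s)
        moreover have "q dvd p * s" using s by (metis dvd_triv_left mult.assoc)
        moreover have "\<not> q dvd p"
          using irreducible_dvd_irreducible[of p q] v \<open>\<not> in_vars m p\<close> p factor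
          by (auto simp: in_vars_def)
        ultimately have "q dvd s" using prime[of q p s] factor v p by blast
        then obtain s' where "s = q * s'" by (elim dvdE)
        then have "q * (c * f) = q * (p * s')" using s by (simp add: mult_ac)
        then have "c * f = p * s'" using factor by (auto simp: irreducible_def)
        then show ?thesis using factor v by simp
      qed simp
    qed
    \<comment> \<open>Each irreducible factor of c is prime and can be removed from Q or from h.
      What is left is a factorisation of k itself, and Q and h have changed only by factors free of
      X_m.\<close>
    have split: "\<exists>Q' h' c1 c2. Q = c1 * Q' \<and> h = c2 * h' \<and> k = Q' * h' \<and> in_vars m c1 \<and> in_vars m c2"
      if "c \<noteq> 0" "in_vars m c" "in_vars (Suc m) Q" "in_vars (Suc m) h" "c * k = Q * h" "k \<noteq> 0"
      for c k Q h :: "'a mpoly"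
      using that
    proof (induction c arbitrary: Q h rule: mpoly_factor_induct)
      case (unit u)
      then obtain u' where u': "1 = u * u'" by (elim dvdE)
      have "k = (u * u') * k" by (simp add: u'[symmetric])
      also have "\<dots> = u' * (u * k)" by (simp only: mult_ac)
      also have "\<dots> = Q * (u' * h)" using unit by (simp add: mult_ac)
      finally have "k = Q * (u' * h)" .
      moreover have "h = u * (u' * h)" using u' by (simp add: mult.assoc[symmetric])
      ultimately show ?case using unit by (intro exI[of _ Q] exI[of _ "u' * h"] exI[of _ 1] exI[of _ u]) auto
    next
      case (factor q c)
      have q0: "q \<noteq> 0" using factor by (auto simp: irreducible_def)
      have v: "in_vars m q" "in_vars m c"
        using factor q0 in_vars_dvd[of _ "q * c" m] by auto
      have ne: "Q \<noteq> 0" "h \<noteq> 0" using factor q0 by auto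
      have "q dvd Q * h" using factor.prems by (metis dvd_triv_left mult.assoc)
      then have "q dvd Q \<or> q dvd h" using prime[of q Q h] factor v by blast
      then show ?case
      proof
        assume "q dvd Q"
        then obtain Q1 where Q1: "Q = q * Q1" by (elim dvdE)
        then have "q * (c * k) = q * (Q1 * h)" using factor.prems by (simp add: mult_ac)
        then have *: "c * k = Q1 * h" using q0 by simp
        have "in_vars (Suc m) Q1" using Q1 ne factor.prems in_vars_dvd[of Q1 Q] by simp
        from factor.IH[OF v(2) this factor.prems(3) * \<open>k \<noteq> 0\<close>] obtain Q' h' c1 c2
          where "Q1 = c1 * Q'" "h = c2 * h'" "k = Q' * h'" "in_vars m c1" "in_vars m c2" by blast
        then show ?thesis using Q1 v
          by (intro exI[of _ Q'] exI[of _ h'] exI[of _ "q * c1"] exI[of _ c2]) (auto intro: in_vars_mult)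
      next
        assume "q dvd h"
        then obtain h1 where h1: "h = q * h1" by (elim dvdE)
        then have "q * (c * k) = q * (Q * h1)" using factor.prems by (simp add: mult_ac)
        then have *: "c * k = Q * h1" using q0 by simp
        have "in_vars (Suc m) h1" using h1 ne factor.prems in_vars_dvd[of h1 h] by simp
        from factor.IH[OF v(2) factor.prems(2) this * \<open>k \<noteq> 0\<close>] obtain Q' h' c1 c2
          where "Q = c1 * Q'" "h1 = c2 * h'" "k = Q' * h'" "in_vars m c1" "in_vars m c2" by blast
        then show ?thesis using h1 v
          by (intro exI[of _ Q'] exI[of _ h'] exI[of _ c1] exI[of _ "q * c2"]) (auto intro: in_vars_mult)
      qed
    qed
    let ?J = "\<lambda>h. h \<noteq> 0 \<and> in_vars (Suc m) h \<and> p dvd h * g"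
    have "?J p" using p by simp
    then obtain h where h: "?J h" and least: "\<And>h'. ?J h' \<Longrightarrow> degv m h \<le> degv m h'"
      using ex_has_least_nat[of ?J p "degv m"] by blast
    have div: "\<exists>c Q. c \<noteq> 0 \<and> in_vars m c \<and> in_vars (Suc m) Q \<and> c * k = Q * h"
      if k: "in_vars (Suc m) k" "p dvd k * g" for k
    proof -
      obtain c Q r where c: "in_vars m c" "c \<noteq> 0" "in_vars (Suc m) Q" "in_vars (Suc m) r"
        "c * k = Q * h + r" "r = 0 \<or> degv m r < degv m h"
        using pseudo_division[of h m k] h k by blast
      have "c * (k * g) = (Q * h + r) * g" by (simp add: c(5)[symmetric] mult.assoc)
      then have "r * g = c * (k * g) - Q * (h * g)" by (simp add: algebra_simps)
      then have "p dvd r * g" using h k by simp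
      then have "r = 0" using least[of r] c by (cases "r = 0") auto
      then show ?thesis using c by auto
    qed
    obtain c Q where cQ: "c \<noteq> 0" "in_vars m c" "in_vars (Suc m) Q" "c * p = Q * h"
      using div[of p] p by auto
    obtain Q' h' c1 c2 where *: "Q = c1 * Q'" "h = c2 * h'" "p = Q' * h'" "in_vars m c1" "in_vars m c2"
      using split[OF cQ(1,2,3) _ cQ(4) p(2)] h by blast
    have ne: "c2 \<noteq> 0" using h * by auto
    \<comment> \<open>If Q' is a unit, then p divides h and therefore c * f. If h' is a unit, then h
      is c2 up to a unit, so p divides c2 * g.\<close>
    from p(1) *(3) consider "Q' dvd 1" | "h' dvd 1" unfolding irreducible_def by blast
    then show ?thesis
    proof cases
      case 1
      then obtain u where u: "1 = Q' * u" by (elim dvdE)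
      have "u * p = (Q' * u) * h'" unfolding *(3) by (simp only: mult_ac)
      then have "h' = u * p" by (simp add: u[symmetric])
      then have "p dvd h'" by (rule dvdI[OF trans[OF _ mult.commute]])
      then have "p dvd h" unfolding *(2) by (rule dvd_mult)
      obtain c Q where cf: "c \<noteq> 0" "in_vars m c" "in_vars (Suc m) Q" "c * f = Q * h"
        using div[of f] Suc.prems by auto
      then have "p dvd c * f" using \<open>p dvd h\<close> by simp
      then show ?thesis using cancel[of c f] cf Suc.prems by blast
    next
      case 2
      have "h * g dvd c2 * g"
        using 2 *(2) by (metis dvd_refl mult_1_right mult_dvd_mono)
      then have "p dvd c2 * g" using h dvd_trans by blast
      then show ?thesis using cancel[of c2 g] ne * Suc.prems by blast
    qed
  qed
qed

lemma irreducible_imp_prime_elem_mpoly: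
  fixes p :: "'a::{factorial_semiring,idom} mpoly"
  assumes "irreducible p"
  shows "prime_elem p"
proof (rule prime_elemI)
  show "p \<noteq> 0" "\<not> p dvd 1" using assms by (auto simp: irreducible_def)
  fix f g assume fg: "p dvd f * g"
  obtain m1 m2 m3 where m: "in_vars m1 p" "in_vars m2 f" "in_vars m3 g" using in_vars_exists by metis
  define m where "m = max m1 (max m2 m3)"
  show "p dvd f \<or> p dvd g"
    by (rule irreducible_imp_prime_in_vars[OF assms _ _ _ fg, of m])
      (auto intro: m[THEN in_vars_mono] simp: m_def)
qed

section \<open>Valuations centred on a polynomial ring\<close>

lemma prime_power_decomposition:
  fixes p q :: "'a::{factorial_semiring,idom} mpoly"
  assumes "p \<noteq> 0" "irreducible q"
  obtains a p' where "p = q ^ a * p'" "\<not> q dvd p'"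
proof -
  obtain m where m: "in_vars m (p * q)" using in_vars_exists by blast
  then have "in_vars m p" "in_vars m q"
    using assms in_vars_dvd[of _ "p * q" m] by (auto simp: irreducible_def)
  moreover from this have "\<exists>a p'. p = q ^ a * p' \<and> \<not> q dvd p'" using assms
  proof (induction "msize m p" arbitrary: p rule: less_induct)
    case less
    show ?case
    proof (cases "q dvd p")
      case True
      then obtain s where s: "p = q * s" by (elim dvdE)
      have ne: "s \<noteq> 0" "q \<noteq> 0" using s less.prems by (auto simp: irreducible_def)
      have v: "in_vars m s" using s less.prems in_vars_dvd[of s p m] by simp
      have "msize m p = msize m q + msize m s" using s ne v less.prems by (simp add: msize_mult)
      moreover have "msize m q \<noteq> 0"
        using msize_eq_0_imp_unit[of m q] less.prems ne by (auto simp: irreducible_def)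
      ultimately obtain a p' where "s = q ^ a * p'" "\<not> q dvd p'"
        using less.hyps[of s] ne v less.prems by auto
      then show ?thesis using s by (intro exI[of _ "Suc a"] exI[of _ p']) (simp add: mult.assoc)
    next
      case False
      then show ?thesis by (intro exI[of _ 0] exI[of _ p]) simp
    qed
  qed
  ultimately show ?thesis using that by blast
qed

text \<open>Has the shape of the exponents in the exchange Laurent polynomials, which thereby become
  multiplicities by unfolding (\<open>exch_exp_mpmult\<close>); it also yields the adic
  valuation.\<close>

definition mpmult :: "'a::{factorial_semiring,idom} mpoly \<Rightarrow> 'a mpoly \<Rightarrow> nat" where
  "mpmult q p = (GREATEST a. q ^ a dvd p)"

lemma mpmult_eqI:
  assumes "q \<noteq> 0" "\<not> q dvd p'" "p = q ^ a * p'"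
  shows "mpmult q p = a"
  unfolding mpmult_def
proof (rule Greatest_equality)
  show "q ^ a dvd p" using assms by simp
  fix b assume "q ^ b dvd p"
  show "b \<le> a"
  proof (rule ccontr)
    assume "\<not> b \<le> a"
    then have "q ^ b = q ^ a * (q * q ^ (b - Suc a))"
      by (simp flip: power_Suc power_add)
    then have "q ^ a * (q * q ^ (b - Suc a)) dvd q ^ a * p'"
      using \<open>q ^ b dvd p\<close> assms by simp
    then have "q * q ^ (b - Suc a) dvd p'" using assms(1) by simp
    then show False using assms(2) by (metis dvd_mult_left)
  qed
qed

text \<open>Additivity rests on primality: two cofactors not divisible by q must have a product not
  divisible by q.\<close>

lemma mpmult_mult:
  assumes "irreducible q" "p \<noteq> 0" "r \<noteq> 0"
  shows "mpmult q (p * r) = mpmult q p + mpmult q r"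
proof -
  obtain a p' where p: "p = q ^ a * p'" "\<not> q dvd p'" using assms prime_power_decomposition by blast
  obtain b r' where r: "r = q ^ b * r'" "\<not> q dvd r'" using assms prime_power_decomposition by blast
  have q: "q \<noteq> 0" "prime_elem q"
    using assms by (auto simp: irreducible_def irreducible_imp_prime_elem_mpoly)
  have "\<not> q dvd p' * r'" using p r q by (auto simp: prime_elem_def)
  moreover have "p * r = q ^ (a + b) * (p' * r')" using p r by (simp add: power_add mult_ac)
  ultimately have "mpmult q (p * r) = a + b" using q by (intro mpmult_eqI)
  moreover have "mpmult q p = a" "mpmult q r = b"
    using mpmult_eqI[of q p' p a] mpmult_eqI[of q r' r b] p r q by simp_all
  ultimately show ?thesis by simp
qed

lemma mpmult_power_dvd:
  assumes "irreducible q" "p \<noteq> 0"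
  shows "q ^ a dvd p \<longleftrightarrow> a \<le> mpmult q p"
proof -
  obtain b p' where p: "p = q ^ b * p'" "\<not> q dvd p'" using assms prime_power_decomposition by blast
  have q: "q \<noteq> 0" using assms by (auto simp: irreducible_def)
  have b: "mpmult q p = b" using p q by (auto intro!: mpmult_eqI)
  show ?thesis
  proof
    assume "a \<le> mpmult q p"
    then show "q ^ a dvd p" using b p by (simp add: le_imp_power_dvd)
  next
    assume "q ^ a dvd p"
    then show "a \<le> mpmult q p"
    proof (rule contrapos_pp)
      assume "\<not> a \<le> mpmult q p"
      then have "Suc b \<le> a" using b by simp
      show "\<not> q ^ a dvd p"
      proof
        assume "q ^ a dvd p"
        then have "q ^ Suc b dvd p" using \<open>Suc b \<le> a\<close> by (metis dvd_trans le_imp_power_dvd)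
        then have "q ^ b * q dvd q ^ b * p'" using p by (simp add: mult.commute)
        then show False using q p by simp
      qed
    qed
  qed
qed

lemma mpmult_add:
  assumes "irreducible q" "p \<noteq> 0" "r \<noteq> 0" "p + r \<noteq> 0"
  shows "min (mpmult q p) (mpmult q r) \<le> mpmult q (p + r)"
  using assms by (subst mpmult_power_dvd[symmetric]) (auto intro!: dvd_add simp: mpmult_power_dvd)

section \<open>Evaluation in the field of rational functions\<close>

lemma to_fr_simps [simp]: "to_fr 0 = 0" "to_fr 1 = 1"
  by (simp_all add: to_fr_def fract_collapse)

lemma to_fr_add: "to_fr (p + q) = to_fr p + to_fr q"
  by (simp add: to_fr_def)

lemma to_fr_mult: "to_fr (p * q) = to_fr p * to_fr q"
  by (simp add: to_fr_def)

lemma ring_hom_to_fr: "ring_hom to_fr"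
  by (simp add: ring_hom_def to_fr_add to_fr_mult)

lemma to_fr_inj [simp]: "to_fr p = to_fr q \<longleftrightarrow> p = q"
  by (simp add: to_fr_def eq_fract)

lemma to_fr_eq_0_iff [simp]: "to_fr p = 0 \<longleftrightarrow> p = 0"
  using to_fr_inj[of p 0] by (simp del: to_fr_inj)

lemma ring_hom_const_fr: "ring_hom (\<lambda>c. to_fr (Const c))"
  by (rule ring_hom_comp[OF ring_hom_to_fr ring_hom_Const])

lemma ring_hom_evalF: "ring_hom (evalF x)"
  unfolding evalF_def[abs_def] by (rule ring_hom_eval_mp[OF ring_hom_const_fr])

lemmas evalF_simps [simp] = ring_homD[OF ring_hom_evalF] ring_hom_power[OF ring_hom_evalF]
  ring_hom_minus[OF ring_hom_evalF]
lemmas evalF_sum = ring_hom_sum[OF ring_hom_evalF]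
lemmas evalF_prod = ring_hom_prod[OF ring_hom_evalF]

lemma evalF_Var [simp]: "evalF x (Var j) = x j"
  by (simp add: evalF_def eval_mp_Var[OF ring_hom_const_fr])

lemma evalF_Const [simp]: "evalF x (Const c) = to_fr (Const c)"
  by (simp add: evalF_def eval_mp_Const[OF ring_hom_const_fr])

lemma evalF_cong: "(\<And>j. j \<in> vars p \<Longrightarrow> x j = y j) \<Longrightarrow> evalF x p = evalF y p"
  unfolding evalF_def by (rule eval_mp_cong)

lemma evalF_subst: "evalF x (subst_mp s p) = evalF (\<lambda>j. evalF x (s j)) p"
  unfolding evalF_def by (rule eval_mp_subst[OF ring_hom_const_fr])

lemma evalF_to_fr_Var: "evalF (\<lambda>l. to_fr (Var l)) p = to_fr p"
proof -
  have "to_fr p = to_fr (eval_mp Const Var p)" by (simp add: eval_mp_Const_Var)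
  also have "\<dots> = evalF (\<lambda>l. to_fr (Var l)) p"
    unfolding evalF_def by (rule hom_eval_mp[OF ring_hom_to_fr])
  finally show ?thesis by simp
qed

text \<open>The numerator of p after the substitution of A / B for X_j, cleared by the power of B
  given by the degree in X_j. It brings identities between fractions back to polynomials, where
  divisibility makes sense and evaluation at any cluster is possible.\<close>

definition homog :: "nat \<Rightarrow> 'a::idom mpoly \<Rightarrow> 'a mpoly \<Rightarrow> 'a mpoly \<Rightarrow> 'a mpoly" where
  "homog j p A B = (\<Sum>i\<le>degv j p. coeff (upoly j p) i * A ^ i * B ^ (degv j p - i))"

lemma mpoly_expand: "p = (\<Sum>i\<le>degv j p. coeff (upoly j p) i * Var j ^ i)"
  using poly_altdef[of "upoly j p" "Var j"] by (simp add: degv_def)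

lemma evalF_homog:
  assumes "evalF v B \<noteq> 0"
  shows "evalF v (homog j p A B) = evalF v B ^ degv j p * evalF (v(j := evalF v A / evalF v B)) p"
proof -
  let ?v = "v(j := evalF v A / evalF v B)"
  have c: "evalF ?v (coeff (upoly j p) i) = evalF v (coeff (upoly j p) i)" for i
    using vars_coeff_upoly[of j p i] by (intro evalF_cong) auto
  have "evalF ?v p = (\<Sum>i\<le>degv j p. evalF ?v (coeff (upoly j p) i * Var j ^ i))"
    by (subst mpoly_expand[of p j]) (rule evalF_sum)
  also have "\<dots> = (\<Sum>i\<le>degv j p. evalF v (coeff (upoly j p) i) * (evalF v A / evalF v B) ^ i)"
    by (simp add: c)
  finally have "evalF v B ^ degv j p * evalF ?v p =
    (\<Sum>i\<le>degv j p. evalF v B ^ degv j p * (evalF v (coeff (upoly j p) i) * (evalF v A / evalF v B) ^ i))"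
    by (simp only: sum_distrib_left)
  also have "\<dots> = evalF v (homog j p A B)"
    unfolding homog_def evalF_sum
  proof (rule sum.cong[OF refl])
    fix i assume "i \<in> {..degv j p}"
    then have "evalF v B ^ degv j p = evalF v B ^ i * evalF v B ^ (degv j p - i)"
      by (simp flip: power_add)
    then show "evalF v B ^ degv j p * (evalF v (coeff (upoly j p) i) * (evalF v A / evalF v B) ^ i) =
      evalF v (coeff (upoly j p) i * A ^ i * B ^ (degv j p - i))"
      using assms by (simp add: power_divide)
  qed
  finally show ?thesis by simp
qed

text \<open>Replacing X_j by B X_j / B changes nothing, so only the clearing power of B
  remains.\<close>

lemma homog_Var: "homog j p (B * Var j) B = B ^ degv j p * p"
proof -
  have "homog j p (B * Var j) B = (\<Sum>i\<le>degv j p. B ^ degv j p * (coeff (upoly j p) i * Var j ^ i))"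
    unfolding homog_def
  proof (rule sum.cong[OF refl])
    fix i assume "i \<in> {..degv j p}"
    then have "B ^ degv j p = B ^ i * B ^ (degv j p - i)" by (simp flip: power_add)
    then show "coeff (upoly j p) i * (B * Var j) ^ i * B ^ (degv j p - i) =
        B ^ degv j p * (coeff (upoly j p) i * Var j ^ i)"
      by (simp add: power_mult_distrib mult_ac)
  qed
  also have "\<dots> = B ^ degv j p * p"
    by (simp add: sum_distrib_left[symmetric] mpoly_expand[symmetric])
  finally show ?thesis .
qed

text \<open>Lets the denominator be changed modulo t. It is applied with t = X_k, modulo which F_j
  agrees with its value at X_k = 0.\<close>

lemma homog_diff_dvd:
  assumes "t dvd B - B'"
  shows "t dvd homog j p A B - homog j p A B'"
proof -
  have "t dvd B ^ e - B' ^ e" for e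
  proof (induction e)
    case (Suc e)
    have "B ^ Suc e - B' ^ Suc e = B * (B ^ e - B' ^ e) + (B - B') * B' ^ e"
      by (simp add: algebra_simps)
    then show ?case using Suc assms by simp
  qed simp
  then have "t dvd (coeff (upoly j p) i * A ^ i) * (B ^ e - B' ^ e)" for i e by simp
  then show ?thesis
    unfolding homog_def sum_subtractf[symmetric] right_diff_distrib[symmetric]
    by (intro dvd_sum) blast
qed

lemma in_vars_coeff_upoly: "in_vars n p \<Longrightarrow> in_vars n (coeff (upoly j p) i)"
  using vars_coeff_upoly[of j p i] by (auto simp: in_vars_def)

lemma in_vars_sum: "(\<And>i. i \<in> A \<Longrightarrow> in_vars n (f i)) \<Longrightarrow> in_vars n (sum f A)"
  using vars_sum[of A f "{..<n}"] by (simp add: in_vars_def)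

lemma in_vars_homog: "in_vars n p \<Longrightarrow> in_vars n A \<Longrightarrow> in_vars n B \<Longrightarrow> in_vars n (homog j p A B)"
  unfolding homog_def by (intro in_vars_sum in_vars_mult in_vars_power in_vars_coeff_upoly)

text \<open>Clearing F turns a relation p among the new coordinates into one among the old. As F
  avoids X_k, the coefficients of the latter in X_k are those of p times powers of F, and the
  leading coefficient is kept unchanged; so it vanishes.\<close>

lemma alg_indep_divide:
  fixes F :: "'a::{factorial_semiring,idom,ring_char_0} mpoly"
  assumes x: "alg_indep n x" and k: "k < n" and F: "F \<noteq> 0" "in_vars n F" "k \<notin> vars F"
  shows "alg_indep n (x(k := x k / evalF x F))"
  unfolding alg_indep_def
proof (intro allI impI)
  fix p assume p: "in_vars n p" "evalF (x(k := x k / evalF x F)) p = 0"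
  have "evalF x F \<noteq> 0" using x F by (auto simp: alg_indep_def)
  then have "evalF x (homog k p (Var k) F) = 0" using p by (simp add: evalF_homog)
  then have 0: "homog k p (Var k) F = 0"
    using x p F k by (auto simp: alg_indep_def intro!: in_vars_homog in_vars_Var)
  define P where "P = (\<Sum>i\<le>degv k p. Polynomial.monom (coeff (upoly k p) i * F ^ (degv k p - i)) i)"
  have coeff_P: "coeff P i = (if i \<le> degv k p then coeff (upoly k p) i * F ^ (degv k p - i) else 0)" for i
    unfolding P_def coeff_sum by (simp add: if_distrib[where f = "\<lambda>x. coeff x _"])
  have "poly P (Var k) = homog k p (Var k) F"
    by (simp add: P_def homog_def poly_sum poly_monom mult_ac)
  moreover have "k \<notin> vars (coeff P i)" for i
    using vars_coeff_upoly[of k p i] F(3) vars_power[of F "degv k p - i"]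
      vars_mult[of "coeff (upoly k p) i" "F ^ (degv k p - i)"] by (auto simp: coeff_P)
  ultimately have "P = 0" using 0 upoly_poly[of k P] by (simp add: upoly_simps)
  then have "lcv k p = 0" using coeff_P[of "degv k p"] by (simp add: lcv_def degv_def)
  then show "p = 0" by simp
qed

text \<open>The fractions of polynomials in z whose denominator has value 0. The inductive form
  means that inclusion of one such ring in another is checked on generators only
  (\<open>loc_subset\<close>); \<open>loc_quotient\<close> recovers a single numerator and
  denominator.\<close>

inductive_set loc :: "('a::{factorial_semiring,idom,ring_char_0} ratfun \<Rightarrow> int) \<Rightarrow> nat \<Rightarrow> (nat \<Rightarrow> 'a ratfun) \<Rightarrow> 'a ratfun set"
  for w n z where
  loc_const: "to_fr (Const c) \<in> loc w n z"
| loc_var: "l < n \<Longrightarrow> z l \<in> loc w n z"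
| loc_add: "f \<in> loc w n z \<Longrightarrow> g \<in> loc w n z \<Longrightarrow> f + g \<in> loc w n z"
| loc_mult: "f \<in> loc w n z \<Longrightarrow> g \<in> loc w n z \<Longrightarrow> f * g \<in> loc w n z"
| loc_inverse: "f \<in> loc w n z \<Longrightarrow> f \<noteq> 0 \<Longrightarrow> w f = 0 \<Longrightarrow> inverse f \<in> loc w n z"

lemma loc_divide: "f \<in> loc w n z \<Longrightarrow> g \<in> loc w n z \<Longrightarrow> g \<noteq> 0 \<Longrightarrow> w g = 0 \<Longrightarrow> f / g \<in> loc w n z"
  by (simp add: divide_inverse loc_mult loc_inverse)

lemma loc_one: "1 \<in> loc w n z"
  using loc_const[of 1 w n z] by (simp add: Const_one)

lemma loc_zero: "0 \<in> loc w n z"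
  using loc_const[of 0 w n z] by (simp add: Const_zero)

lemma loc_power: "f \<in> loc w n z \<Longrightarrow> f ^ e \<in> loc w n z"
  by (induction e) (auto intro: loc_mult loc_one)

lemma loc_uminus:
  assumes "f \<in> loc w n z"
  shows "- f \<in> loc w n z"
proof -
  have "to_fr (Const (- 1)) = - 1"
    using ring_hom_minus(1)[OF ring_hom_const_fr, of 1] by (simp add: Const_one)
  then show ?thesis using loc_mult[OF loc_const[of "- 1" w n z] assms] by (metis mult_minus1)
qed

lemma loc_diff: "f \<in> loc w n z \<Longrightarrow> g \<in> loc w n z \<Longrightarrow> f - g \<in> loc w n z"
  using loc_add[of f w n z "- g"] loc_uminus[of g w n z] by simp

lemma loc_evalF:
  assumes "\<And>l. l \<in> vars p \<Longrightarrow> x l \<in> loc w n z"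
  shows "evalF x p \<in> loc w n z"
proof -
  have prod: "prod f A \<in> loc w n z" if "\<And>j. j \<in> A \<Longrightarrow> f j \<in> loc w n z" for f and A :: "nat set"
    using that by (induction A rule: infinite_finite_induct) (auto intro: loc_one loc_mult)
  have sum: "sum f A \<in> loc w n z" if "\<And>j. j \<in> A \<Longrightarrow> f j \<in> loc w n z" for f and A :: "(nat \<Rightarrow>\<^sub>0 nat) set"
    using that by (induction A rule: infinite_finite_induct) (auto intro: loc_zero loc_add)
  show ?thesis
    unfolding evalF_def eval_mp_def
  proof (intro sum prod loc_mult loc_power loc_const)
    fix \<alpha> j assume "\<alpha> \<in> Poly_Mapping.keys p" "j \<in> Poly_Mapping.keys \<alpha>"
    then show "x j \<in> loc w n z" by (intro assms) (auto simp: vars_def)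
  qed
qed

lemma loc_subset:
  assumes "\<And>l. l < n \<Longrightarrow> z l \<in> loc w m z'"
  shows "loc w n z \<subseteq> loc w m z'"
proof
  fix f assume "f \<in> loc w n z"
  then show "f \<in> loc w m z'"
    by induction (auto intro: assms loc.intros)
qed

text \<open>There is no value for 0, hence the restriction to nonzero elements. Constants have value
  at least 0 rather than exactly 0, because an exchange polynomial may be an irreducible element of
  R; its adic valuation is then not trivial on R.\<close>

locale valuation_on =
  fixes K :: "'a::{factorial_semiring,idom,ring_char_0} ratfun set"
    and w :: "'a ratfun \<Rightarrow> int"
  assumes K_const: "to_fr (Const c) \<in> K"
    and K_add: "f \<in> K \<Longrightarrow> g \<in> K \<Longrightarrow> f + g \<in> K"
    and K_mult: "f \<in> K \<Longrightarrow> g \<in> K \<Longrightarrow> f * g \<in> K"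
    and K_inverse: "f \<in> K \<Longrightarrow> inverse f \<in> K"
    and w_mult: "f \<in> K \<Longrightarrow> g \<in> K \<Longrightarrow> f \<noteq> 0 \<Longrightarrow> g \<noteq> 0 \<Longrightarrow> w (f * g) = w f + w g"
    and w_add: "f \<in> K \<Longrightarrow> g \<in> K \<Longrightarrow> f \<noteq> 0 \<Longrightarrow> g \<noteq> 0 \<Longrightarrow> f + g \<noteq> 0 \<Longrightarrow> min (w f) (w g) \<le> w (f + g)"
    and w_const: "c \<noteq> 0 \<Longrightarrow> 0 \<le> w (to_fr (Const c))"
begin

lemma K_one: "1 \<in> K"
  using K_const[of 1] by (simp add: Const_one)

lemma K_divide: "f \<in> K \<Longrightarrow> g \<in> K \<Longrightarrow> f / g \<in> K"
  by (simp add: divide_inverse K_mult K_inverse)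

lemma K_power: "f \<in> K \<Longrightarrow> f ^ e \<in> K"
  by (induction e) (auto intro: K_mult K_one)

lemma w_one: "w 1 = 0"
  using w_mult[of 1 1] K_one by simp

lemma w_inverse: "f \<in> K \<Longrightarrow> f \<noteq> 0 \<Longrightarrow> w (inverse f) = - w f"
  using w_mult[of f "inverse f"] K_inverse[of f] w_one by simp

lemma w_divide: "f \<in> K \<Longrightarrow> g \<in> K \<Longrightarrow> f \<noteq> 0 \<Longrightarrow> g \<noteq> 0 \<Longrightarrow> w (f / g) = w f - w g"
  by (simp add: divide_inverse w_mult K_inverse w_inverse)

lemma w_power: "f \<in> K \<Longrightarrow> f \<noteq> 0 \<Longrightarrow> w (f ^ e) = int e * w f"
  by (induction e) (auto simp: w_one w_mult K_power algebra_simps)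

lemma w_unit:
  assumes "u dvd 1"
  shows "w (to_fr (Const u)) = 0" "to_fr (Const u) \<noteq> 0"
proof -
  obtain v where v: "1 = u * v" using assms by (elim dvdE)
  then have "u \<noteq> 0" "v \<noteq> 0" by auto
  moreover have "to_fr (Const u) * to_fr (Const v) = 1"
    using v by (simp flip: to_fr_mult Const_mult add: Const_one)
  ultimately have "w (to_fr (Const u)) + w (to_fr (Const v)) = 0" "to_fr (Const u) \<noteq> 0" "to_fr (Const v) \<noteq> 0"
    using w_mult[of "to_fr (Const u)" "to_fr (Const v)"] K_const w_one by auto
  then show "w (to_fr (Const u)) = 0" "to_fr (Const u) \<noteq> 0"
    using w_const[of u] w_const[of v] by auto
qed

text \<open>Together with \<open>centred_loc_nonneg\<close> the second clause says that the
  valuation ring is exactly the localisation. With all coordinates units, monomials in the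
  denominators of Laurent polynomials do no harm.\<close>

definition centred :: "nat \<Rightarrow> (nat \<Rightarrow> 'a ratfun) \<Rightarrow> bool" where
  "centred n z \<longleftrightarrow> (\<forall>l<n. z l \<in> K \<and> z l \<noteq> 0 \<and> w (z l) = 0) \<and>
     (\<forall>f\<in>K. f \<noteq> 0 \<longrightarrow> 0 \<le> w f \<longrightarrow> f \<in> loc w n z)"

lemma centredD:
  assumes "centred n z" "l < n"
  shows "z l \<in> K" "z l \<noteq> 0" "w (z l) = 0"
  using assms by (auto simp: centred_def)

lemma centred_loc: "centred n z \<Longrightarrow> f \<in> K \<Longrightarrow> f \<noteq> 0 \<Longrightarrow> 0 \<le> w f \<Longrightarrow> f \<in> loc w n z"
  by (auto simp: centred_def)

text \<open>The valuation ring does not depend on coordinates, so it is enough to find the old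
  coordinates in the localisation of the new ones. Every mutation below is treated in this
  way.\<close>

lemma centred_transfer:
  assumes "centred n z"
    and "\<And>l. l < n \<Longrightarrow> z' l \<in> K \<and> z' l \<noteq> 0 \<and> w (z' l) = 0"
    and "\<And>l. l < n \<Longrightarrow> z l \<in> loc w n z'"
  shows "centred n z'"
  using assms loc_subset[of n z w n z'] by (auto simp: centred_def)

lemma loc_in_K_nonneg:
  assumes "f \<in> loc w n z" "\<And>l. l < n \<Longrightarrow> z l \<in> K \<and> (z l \<noteq> 0 \<longrightarrow> 0 \<le> w (z l))"
  shows "f \<in> K \<and> (f \<noteq> 0 \<longrightarrow> 0 \<le> w f)"
  using assms(1)
proof induction
  case (loc_const c)
  then show ?case by (auto intro: K_const w_const)
next
  case (loc_add f g)
  then show ?case using w_add[of f g] by (cases "f = 0"; cases "g = 0") (auto intro: K_add)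
next
  case (loc_mult f g)
  then show ?case using w_mult[of f g] by (auto intro: K_mult)
qed (use assms(2) in \<open>auto intro: K_inverse simp: w_inverse\<close>)

lemma centred_loc_nonneg:
  assumes "centred n z" "f \<in> loc w n z"
  shows "f \<in> K" "f \<noteq> 0 \<Longrightarrow> 0 \<le> w f"
  using loc_in_K_nonneg[OF assms(2)] assms(1) by (auto simp: centred_def)

lemma evalF_loc: "in_vars n p \<Longrightarrow> evalF z p \<in> loc w n z"
  by (intro loc_evalF loc_var) (auto simp: in_vars_def)

lemma evalF_in_K:
  assumes "in_vars n p" "\<And>l. l < n \<Longrightarrow> z l \<in> K"
  shows "evalF z p \<in> K"
proof -
  have prod: "prod f A \<in> K" if "\<And>j. j \<in> A \<Longrightarrow> f j \<in> K" for f and A :: "nat set"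
    using that by (induction A rule: infinite_finite_induct) (auto intro: K_one K_mult)
  have "0 \<in> K" using K_const[of 0] by (simp add: Const_zero)
  then have sum: "sum f A \<in> K" if "\<And>j. j \<in> A \<Longrightarrow> f j \<in> K" for f and A :: "(nat \<Rightarrow>\<^sub>0 nat) set"
    using that by (induction A rule: infinite_finite_induct) (auto intro: K_add)
  show ?thesis
    unfolding evalF_def eval_mp_def
  proof (intro sum prod K_mult K_power K_const)
    fix \<alpha> j assume "\<alpha> \<in> Poly_Mapping.keys p" "j \<in> Poly_Mapping.keys \<alpha>"
    then show "z j \<in> K" using assms by (auto simp: vars_def in_vars_def)
  qed
qed

lemma loc_quotient:
  assumes "f \<in> loc w n z" and z: "\<And>l. l < n \<Longrightarrow> z l \<in> K"
  shows "\<exists>a b. in_vars n a \<and> in_vars n b \<and> evalF z b \<noteq> 0 \<and> w (evalF z b) = 0 \<and> f = evalF z a / evalF z b"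
  using assms(1)
proof induction
  case (loc_const c)
  then show ?case by (intro exI[of _ "Const c"] exI[of _ 1]) (simp add: w_one)
next
  case (loc_var l)
  then show ?case by (intro exI[of _ "Var l"] exI[of _ 1]) (simp add: w_one in_vars_Var)
next
  case (loc_add f g)
  then obtain a b c d where "in_vars n a" "in_vars n b" "evalF z b \<noteq> 0" "w (evalF z b) = 0"
    "f = evalF z a / evalF z b" "in_vars n c" "in_vars n d" "evalF z d \<noteq> 0" "w (evalF z d) = 0"
    "g = evalF z c / evalF z d" by auto
  then show ?case
    by (intro exI[of _ "a * d + c * b"] exI[of _ "b * d"])
      (simp add: in_vars_add in_vars_mult w_mult evalF_in_K z add_frac_eq)
next
  case (loc_mult f g)
  then obtain a b c d where "in_vars n a" "in_vars n b" "evalF z b \<noteq> 0" "w (evalF z b) = 0"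
    "f = evalF z a / evalF z b" "in_vars n c" "in_vars n d" "evalF z d \<noteq> 0" "w (evalF z d) = 0"
    "g = evalF z c / evalF z d" by auto
  then show ?case
    by (intro exI[of _ "a * c"] exI[of _ "b * d"])
      (simp add: in_vars_mult w_mult evalF_in_K z)
next
  case (loc_inverse f)
  then obtain a b where *: "in_vars n a" "in_vars n b" "evalF z b \<noteq> 0" "w (evalF z b) = 0"
    "f = evalF z a / evalF z b" by auto
  then have "evalF z a \<noteq> 0" using loc_inverse by auto
  moreover from this have "w (evalF z a) = 0"
    using * loc_inverse w_divide[of "evalF z a" "evalF z b"] by (simp add: evalF_in_K z)
  ultimately show ?case using * by (intro exI[of _ b] exI[of _ a]) simp
qed

lemma centred_evalF_nonneg:
  assumes "centred n z" "in_vars n p" "evalF z p \<noteq> 0"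
  shows "0 \<le> w (evalF z p)"
  using centred_loc_nonneg[OF assms(1) evalF_loc[OF assms(2)]] assms(3) by simp

text \<open>With e and s the values of q and p, the quotient p^e / q^s is a unit of the localisation, so q
  divides p^e b for some b outside the centre.\<close>

lemma centred_dvd:
  assumes z: "centred n z" "alg_indep n z"
    and q: "irreducible q" "in_vars n q" "0 < w (evalF z q)"
    and p: "in_vars n p" "p \<noteq> 0" "w (evalF z p) \<noteq> 0"
  shows "q dvd p"
proof -
  have inj: "evalF z r = 0 \<longleftrightarrow> r = 0" if "in_vars n r" for r
    using that z(2) by (auto simp: alg_indep_def)
  have inK: "evalF z r \<in> K" if "in_vars n r" for r
    using evalF_in_K[OF that] centredD(1)[OF z(1)] by blast
  have q0: "q \<noteq> 0" using q by (auto simp: irreducible_def)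
  have ne: "evalF z p \<noteq> 0" "evalF z q \<noteq> 0" using inj p q q0 by auto
  have wp: "0 < w (evalF z p)" using centred_evalF_nonneg[OF z(1) p(1) ne(1)] p(3) by simp
  define e s where "e = nat (w (evalF z q))" and "s = nat (w (evalF z p))"
  define f where "f = evalF z p ^ e / evalF z q ^ s"
  have "w f = 0"
    using ne p q wp by (simp add: f_def w_divide w_power inK K_power e_def s_def)
  moreover have "f \<noteq> 0" "f \<in> K" using ne p q by (simp_all add: f_def inK K_power K_divide)
  ultimately have "f \<in> loc w n z" using centred_loc z by simp
  then obtain a b where ab: "in_vars n a" "in_vars n b" "evalF z b \<noteq> 0" "w (evalF z b) = 0"
    "f = evalF z a / evalF z b"
    using loc_quotient[of f n z] centredD(1)[OF z(1)] by blast
  have "evalF z (p ^ e * b) = evalF z (q ^ s * a)"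
    using ab(5) ab(3) ne by (simp add: f_def field_simps)
  then have "evalF z (p ^ e * b - q ^ s * a) = 0" by simp
  then have "p ^ e * b = q ^ s * a"
    using inj[of "p ^ e * b - q ^ s * a"] ab p q by (simp add: in_vars_diff in_vars_mult in_vars_power)
  moreover have "s \<noteq> 0" using wp by (simp add: s_def)
  ultimately have "q dvd p ^ e * b" by simp
  then have "q dvd p ^ e \<or> q dvd b"
    using irreducible_imp_prime_elem_mpoly[OF q(1)] by (auto simp: prime_elem_def)
  then show ?thesis
  proof
    assume "q dvd p ^ e"
    then show ?thesis
      using irreducible_imp_prime_elem_mpoly[OF q(1)] prime_elem_dvd_power by blast
  next
    \<comment> \<open>Excluded, because b would then have positive value.\<close>
    assume "q dvd b"
    then obtain c where c: "b = q * c" by (elim dvdE)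
    have "b \<noteq> 0" using ab by auto
    then have "in_vars n c" "evalF z c \<noteq> 0" using c ab in_vars_dvd[of c b n] by auto
    then have "w (evalF z b) = w (evalF z q) + w (evalF z c)" "0 \<le> w (evalF z c)"
      using c ne q centred_evalF_nonneg[OF z(1)] by (simp_all add: w_mult inK)
    then show ?thesis using ab(4) q(3) by simp
  qed
qed

end

text \<open>The value is the multiplicity of q in the numerator minus that in the denominator, on
  the fraction field of R[z]. Since q divides no X_l, the coordinates are units.\<close>

lemma adic_valuation_exists:
  fixes q :: "'a::{factorial_semiring,idom,ring_char_0} mpoly"
  assumes z: "alg_indep n z" and q: "irreducible q" "in_vars n q" "\<And>l. l < n \<Longrightarrow> \<not> q dvd Var l"
  obtains K w where "valuation_on K w" "valuation_on.centred K w n z" "w (evalF z q) = 1"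
proof -
  have inj: "evalF z r = 0 \<longleftrightarrow> r = 0" if "in_vars n r" for r
    using that z by (auto simp: alg_indep_def)
  have inj2: "r = r'" if "in_vars n r" "in_vars n r'" "evalF z r = evalF z r'" for r r'
    using inj[of "r - r'"] that by (simp add: in_vars_diff)
  define rep where "rep f a b \<longleftrightarrow> in_vars n a \<and> in_vars n b \<and> b \<noteq> 0 \<and> f = evalF z a / evalF z b"
    for f a b
  define K where "K = {f. \<exists>a b. rep f a b}"
  define w where "w f = (case (SOME ab. rep f (fst ab) (snd ab)) of (a, b) \<Rightarrow> int (mpmult q a) - int (mpmult q b))" for f
  \<comment> \<open>Two representations a / b and c / d satisfy a d = c b by algebraic independence,
    and multiplicities add; so the choice made by \<open>SOME\<close> is immaterial.\<close>
  have w: "w f = int (mpmult q a) - int (mpmult q b)" if f: "rep f a b" "f \<noteq> 0" for f a b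
  proof -
    define cd where "cd = (SOME ab. rep f (fst ab) (snd ab))"
    have "rep f (fst (a, b)) (snd (a, b))" using f by simp
    then have "rep f (fst cd) (snd cd)" unfolding cd_def by (rule someI)
    then obtain c d where cd: "cd = (c, d)" "rep f c d" by (cases cd) auto
    have ne: "a \<noteq> 0" "b \<noteq> 0" "c \<noteq> 0" "d \<noteq> 0" using f cd by (auto simp: rep_def)
    have "evalF z (a * d) = evalF z (c * b)"
      using f(1) cd(2) ne by (auto simp: rep_def inj frac_eq_eq)
    then have "a * d = c * b"
      using f cd by (intro inj2) (auto simp: rep_def in_vars_mult)
    then have "mpmult q a + mpmult q d = mpmult q c + mpmult q b"
      using mpmult_mult[OF q(1)] ne by metis
    then show ?thesis unfolding w_def cd_def[symmetric] cd(1) by simp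
  qed
  have q0: "q \<noteq> 0" "\<not> q dvd 1" using q by (auto simp: irreducible_def)
  have mpmult_0: "mpmult q a = 0" if "\<not> q dvd a" for a
    using that mpmult_eqI[of q a a 0] q0 by simp
  have rep_evalF: "rep (evalF z a) a 1" if "in_vars n a" for a
    using that by (simp add: rep_def)
  have w_evalF: "w (evalF z a) = int (mpmult q a)" if "in_vars n a" "a \<noteq> 0" for a
    using w[OF rep_evalF] that mpmult_0[OF q0(2)] inj by simp
  have rep_mult: "rep (f * g) (a * c) (b * d)" if "rep f a b" "rep g c d" for f g a b c d
    using that by (auto simp: rep_def in_vars_mult)
  have rep_add: "rep (f + g) (a * d + c * b) (b * d)" if "rep f a b" "rep g c d" for f g a b c d
    using that by (auto simp: rep_def in_vars_mult in_vars_add inj add_frac_eq)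
  have rep_inverse: "rep (inverse f) b a" if "rep f a b" "f \<noteq> 0" for f a b
    using that by (auto simp: rep_def)
  have rep0: "f \<noteq> 0 \<Longrightarrow> a \<noteq> 0 \<and> b \<noteq> 0" if "rep f a b" for f a b using that by (auto simp: rep_def)
  have K_evalF: "evalF z a \<in> K" if "in_vars n a" for a
    using rep_evalF[OF that] by (auto simp: K_def)
  have val: "valuation_on K w"
  proof
    show "to_fr (Const c) \<in> K" for c using K_evalF[of "Const c"] by simp
    show "0 \<le> w (to_fr (Const c))" if "c \<noteq> 0" for c using w_evalF[of "Const c"] that by simp
    fix f assume f: "f \<in> K"
    then obtain a b where ab: "rep f a b" by (auto simp: K_def)
    show "inverse f \<in> K"
      using rep_inverse[OF ab] f by (cases "f = 0") (auto simp: K_def)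
    fix g assume g: "g \<in> K"
    then obtain c d where cd: "rep g c d" by (auto simp: K_def)
    show "f + g \<in> K" "f * g \<in> K" using rep_add[OF ab cd] rep_mult[OF ab cd] by (auto simp: K_def)
    assume ne: "f \<noteq> 0" "g \<noteq> 0"
    show "w (f * g) = w f + w g"
      using w[OF ab] w[OF cd] w[OF rep_mult[OF ab cd]] ne rep0[OF ab] rep0[OF cd]
      by (simp add: mpmult_mult[OF q(1)])
    assume "f + g \<noteq> 0"
    moreover have "min (mpmult q (a * d)) (mpmult q (c * b)) \<le> mpmult q (a * d + c * b)"
      using ne rep0[OF ab] rep0[OF cd] rep0[OF rep_add[OF ab cd]] \<open>f + g \<noteq> 0\<close>
      by (intro mpmult_add[OF q(1)]) auto
    ultimately show "min (w f) (w g) \<le> w (f + g)"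
      using w[OF ab] w[OF cd] w[OF rep_add[OF ab cd]] ne rep0[OF ab] rep0[OF cd]
      by (simp add: mpmult_mult[OF q(1)])
  qed
  interpret valuation_on K w by (rule val)
  have "centred n z"
    unfolding centred_def
  proof (intro conjI allI impI ballI)
    fix l assume l: "l < n"
    have "in_vars n (Var l :: 'a mpoly)" using l by (rule in_vars_Var)
    then show "z l \<in> K" "z l \<noteq> 0" "w (z l) = 0"
      using K_evalF[of "Var l"] inj[of "Var l"] w_evalF[of "Var l"] mpmult_0[OF q(3)[OF l]] by simp_all
  next
    fix f assume f: "f \<in> K" "f \<noteq> 0" "0 \<le> w f"
    then obtain a b where ab: "rep f a b" by (auto simp: K_def)
    then have ne: "a \<noteq> 0" "b \<noteq> 0" using rep0 f by auto
    \<comment> \<open>Cancelling the common power of q leaves a denominator not divisible by q, that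
      is, one of value 0.\<close>
    obtain s a' where a': "a = q ^ s * a'" "\<not> q dvd a'" using prime_power_decomposition[OF ne(1) q(1)] .
    obtain t b' where b': "b = q ^ t * b'" "\<not> q dvd b'" using prime_power_decomposition[OF ne(2) q(1)] .
    have v: "in_vars n a'" "in_vars n b'"
      using ab ne a' b' in_vars_dvd[of a' a n] in_vars_dvd[of b' b n] by (auto simp: rep_def)
    have "mpmult q a = s" "mpmult q b = t"
      using mpmult_eqI[OF q0(1) a'(2,1)] mpmult_eqI[OF q0(1) b'(2,1)] by auto
    then have "t \<le> s" using w[OF ab f(2)] f(3) by simp
    then have "q ^ s = q ^ (s - t) * q ^ t" by (simp flip: power_add)
    moreover have b'0: "evalF z b' \<noteq> 0" "w (evalF z b') = 0"
      using v ne b' inj[of b'] w_evalF[of b'] mpmult_0[of b'] by auto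
    ultimately have "f = evalF z (q ^ (s - t) * a') / evalF z b'"
      using ab a' b' q inj[of q] q0 by (simp add: rep_def field_simps)
    then show "f \<in> loc w n z"
      using b'0 v q by (auto intro!: loc_divide evalF_loc in_vars_mult in_vars_power simp del: evalF_simps)
  qed
  moreover have "w (evalF z q) = 1"
    using w_evalF[OF q(2) q0(1)] mpmult_eqI[of q 1 q 1] q0 by simp
  ultimately show ?thesis using that val by blast
qed

section \<open>Mutation of the centre of a valuation\<close>

text \<open>In \<open>new_exch_poly\<close> the relation of the removed factor D to P is given
  through the irreducible factors of D. Bounding D by a power of P shows that D involves only
  variables of P.\<close>

lemma dvd_power_of_irreducible_factors:
  fixes D P :: "'a::{factorial_semiring,idom} mpoly"
  assumes "D \<noteq> 0" "\<And>q. irreducible q \<Longrightarrow> q dvd D \<Longrightarrow> q dvd P"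
  shows "\<exists>M. D dvd P ^ M"
  using assms
proof (induction D rule: mpoly_factor_induct)
  case (unit u)
  then show ?case by (intro exI[of _ 0]) simp
next
  case (factor q c)
  then obtain M where "c dvd P ^ M" by (metis dvd_mult)
  moreover have "q dvd P" using factor by simp
  ultimately show ?case by (intro exI[of _ "Suc M"]) (simp add: mult_dvd_mono)
qed

text \<open>X_l is prime, since it divides whatever the substitution X_l = 0 kills. In X_l = F h it
  must therefore divide h, which leaves F a unit.\<close>

lemma irreducible_not_dvd_Var:
  fixes F :: "'a::idom mpoly"
  assumes "irreducible F" "\<not> Var l dvd F"
  shows "\<not> F dvd Var l"
proof
  let ?s = "subst_mp (\<lambda>i. if i = l then 0 else Var i :: 'a mpoly)"
  have dvd: "Var l dvd p" if "?s p = 0" for p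
    using Var_dvd_diff_subst_zero[of l p] that by simp
  assume "F dvd Var l"
  then obtain h where h: "Var l = F * h" by (elim dvdE)
  have "?s F * ?s h = ?s (Var l)" by (simp only: h subst_mp_simps)
  then have "Var l dvd F \<or> Var l dvd h" using dvd by auto
  then have "Var l dvd h" using assms by simp
  then obtain h' where "h = Var l * h'" by (elim dvdE)
  then have "Var l * 1 = Var l * (F * h')" using h by (simp add: mult_ac)
  then have "1 = F * h'" using mult_cancel_left[of "Var l" 1 "F * h'"] by simp
  then show False using assms(1) by (metis dvd_triv_left irreducible_def)
qed

section \<open>Seeds and exchange denominators\<close>

lemma LP_seedD:
  assumes "is_LP_seed n (x, F)"
  shows "alg_indep n x"
    and "i < n \<Longrightarrow> in_vars n (F i)" "i < n \<Longrightarrow> irreducible (F i)" "i < n \<Longrightarrow> i \<notin> vars (F i)"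
    and "i < n \<Longrightarrow> j < n \<Longrightarrow> \<not> Var j dvd F i"
  using assms by (auto simp: is_LP_seed_def trans_basis_def Let_def)

lemma LP_seed_vars:
  assumes "is_LP_seed n (x, F)" "k < n"
  shows "vars (F k) \<subseteq> {..<n} - {k}"
  using LP_seedD(2,4)[OF assms] by (auto simp: in_vars_def)

lemma evalF_eq_on: "vars p \<subseteq> A \<Longrightarrow> (\<And>l. l \<in> A \<Longrightarrow> x l = y l) \<Longrightarrow> evalF x p = evalF y p"
  by (rule evalF_cong) blast

lemma loc_evalF_on: "vars p \<subseteq> A \<Longrightarrow> (\<And>l. l \<in> A \<Longrightarrow> x l \<in> loc w n z) \<Longrightarrow> evalF x p \<in> loc w n z"
  by (rule loc_evalF) blast

lemma vars_exch_den:
  fixes F :: "nat \<Rightarrow> 'a::{factorial_semiring,idom,ring_char_0} mpoly"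
  shows "vars (exch_den n F j E) \<subseteq> {..<n} - ({j} \<union> E)"
  unfolding exch_den_def
proof (rule vars_prod)
  fix l assume "l \<in> {..<n} - ({j} \<union> E)"
  then show "vars (Var l ^ exch_exp F j l :: 'a mpoly) \<subseteq> {..<n} - ({j} \<union> E)"
    using vars_power[of "Var l :: 'a mpoly" "exch_exp F j l"] 
      \<open>l \<in> _\<close> by (auto simp: vars_Var)
qed

text \<open>When the valuation is exceptional in direction k, the power of x_k is the only factor of
  the denominator that can fail to be a unit.\<close>

lemma exch_den_split:
  assumes "k < n" "k \<noteq> j"
  shows "exch_den n F j {} = Var k ^ exch_exp F j k * exch_den n F j {k}"
proof -
  have *: "{..<n} - ({j} \<union> {}) = insert k ({..<n} - ({j} \<union> {k}))" using assms by auto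
  show ?thesis unfolding exch_den_def * by (subst prod.insert) simp_all
qed

lemma exch_exp_mpmult:
  "exch_exp F j k = mpmult (F k) (subst_mp (\<lambda>l. if l = k then F k * Var k else Var l) (F j))"
  by (simp add: exch_exp_def mpmult_def)

lemma vars_monom1: "Poly_Mapping.keys \<alpha> \<subseteq> A \<Longrightarrow> vars (monom1 \<alpha> :: 'a::zero_neq_one mpoly) \<subseteq> A"
  by (auto simp: monom1_def vars_def)

lemma evalF_monom1: "evalF x (monom1 \<alpha>) = (\<Prod>j\<in>Poly_Mapping.keys \<alpha>. x j ^ Poly_Mapping.lookup \<alpha> j)"
  unfolding monom1_def monom_eq_prod[symmetric] by (simp add: evalF_prod)

context valuation_on
begin

text \<open>The units of the valuation ring. Their closure properties replace most computations with
  values.\<close>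

definition U :: "'a ratfun set" where
  "U = {f \<in> K. f \<noteq> 0 \<and> w f = 0}"

lemma U_iff: "f \<in> U \<longleftrightarrow> f \<in> K \<and> f \<noteq> 0 \<and> w f = 0"
  by (simp add: U_def)

lemma U_mult: "f \<in> U \<Longrightarrow> g \<in> U \<Longrightarrow> f * g \<in> U"
  by (simp add: U_iff K_mult w_mult)

lemma U_inverse: "f \<in> U \<Longrightarrow> inverse f \<in> U"
  by (simp add: U_iff K_inverse w_inverse)

lemma U_divide: "f \<in> U \<Longrightarrow> g \<in> U \<Longrightarrow> f / g \<in> U"
  by (simp add: divide_inverse U_mult U_inverse)

lemma U_one: "1 \<in> U"
  by (simp add: U_iff K_one w_one)

lemma U_power: "f \<in> U \<Longrightarrow> f ^ e \<in> U"
  by (induction e) (auto intro: U_mult U_one)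

lemma U_prod: "(\<And>i. i \<in> A \<Longrightarrow> f i \<in> U) \<Longrightarrow> prod f A \<in> U"
  by (induction A rule: infinite_finite_induct) (auto intro: U_one U_mult)

lemma U_unit: "u dvd 1 \<Longrightarrow> to_fr (Const u) \<in> U"
  using w_unit[of u] by (simp add: U_iff K_const)

lemma U_exch_den:
  assumes "\<And>l. l < n \<Longrightarrow> l \<noteq> j \<Longrightarrow> l \<notin> E \<Longrightarrow> x l \<in> U"
  shows "evalF x (exch_den n F j E) \<in> U"
  unfolding exch_den_def evalF_prod using assms by (auto intro!: U_prod U_power)

lemma U_monom1:
  assumes "\<And>l. l \<in> Poly_Mapping.keys \<alpha> \<Longrightarrow> x l \<in> U"
  shows "evalF x (monom1 \<alpha>) \<in> U"
  unfolding evalF_monom1 using assms by (auto intro!: U_prod U_power)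

lemma U_loc_divide: "f \<in> loc w n z \<Longrightarrow> g \<in> loc w n z \<Longrightarrow> g \<in> U \<Longrightarrow> f / g \<in> loc w n z"
  by (simp add: loc_divide U_iff)

lemma U_K_mult: "f \<in> U \<Longrightarrow> g \<in> K \<Longrightarrow> g \<noteq> 0 \<Longrightarrow> f * g \<in> K \<and> f * g \<noteq> 0 \<and> w (f * g) = w g"
  by (simp add: U_iff K_mult w_mult)

lemma centred_U: "centred n z \<Longrightarrow> l < n \<Longrightarrow> z l \<in> U"
  by (simp add: centredD U_iff)

lemma centred_transfer_U:
  assumes "centred n z" "\<And>l. l < n \<Longrightarrow> z' l \<in> U" "\<And>l. l < n \<Longrightarrow> z l \<in> loc w n z'"
  shows "centred n z'"
  using assms by (intro centred_transfer[of n z z']) (auto simp: U_iff)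

text \<open>The valuation is centred at x_k = F_k = 0, with x_k and F_k of the same value: the exceptional
  divisor of the blow-up of that locus.\<close>

definition exc_centred :: "nat \<Rightarrow> (nat \<Rightarrow> 'a ratfun) \<Rightarrow> (nat \<Rightarrow> 'a mpoly) \<Rightarrow> nat \<Rightarrow> bool" where
  "exc_centred n x F k \<longleftrightarrow> centred n (x(k := x k / evalF x (F k))) \<and> 0 < w (evalF x (F k))"

definition adapted :: "nat \<Rightarrow> (nat \<Rightarrow> 'a ratfun) \<Rightarrow> (nat \<Rightarrow> 'a mpoly) \<Rightarrow> bool" where
  "adapted n x F \<longleftrightarrow> centred n x \<or> (\<exists>k<n. exc_centred n x F k)"

text \<open>With m a unit, x'_k = F_k / (m x_k) has the value of F_k. If that is 0, the new cluster
  again consists of units. If it is positive, x'_k / F_k = 1 / (m x_k) is a unit and the valuation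
  becomes exceptional in direction k.\<close>

lemma centred_mutation:
  assumes S: "is_LP_seed n (x, F)" and mut: "LP_mutation n k (x, F) (x', F')"
    and k: "k < n" and x: "centred n x"
  shows "adapted n x' F'"
proof -
  define m where "m = evalF x (exch_den n F k {})"
  note xU = centred_U[OF x]
  have mU: "m \<in> U" unfolding m_def by (intro U_exch_den xU)
  define fk where "fk = evalF x (F k)"
  have x'k: "x' k = fk / m / x k" and x'l: "\<And>l. l < n \<Longrightarrow> l \<noteq> k \<Longrightarrow> x' l = x l"
    using mut by (auto simp: LP_mutation_def hatF_def Let_def fk_def m_def)
  obtain u where u: "u dvd 1" "F' k = Const u * F k"
    using mut by (auto simp: LP_mutation_def Let_def)
  have ne: "fk \<noteq> 0"
    using LP_seedD(1)[OF S] LP_seedD(2,3)[OF S k] by (auto simp: fk_def alg_indep_def irreducible_def)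
  have fK: "fk \<in> K" "0 \<le> w fk"
    using centred_loc_nonneg[OF x evalF_loc] LP_seedD(2)[OF S k] ne by (auto simp: fk_def)
  have F_eq: "evalF x' (F k) = fk" unfolding fk_def
    by (rule evalF_eq_on[OF LP_seed_vars[OF S k]]) (simp add: x'l)
  have m_eq: "evalF y (exch_den n F k {}) = m" if "\<And>l. l < n \<Longrightarrow> l \<noteq> k \<Longrightarrow> y l = x l" for y
    unfolding m_def by (rule evalF_eq_on[OF vars_exch_den]) (simp add: that)
  show ?thesis
  proof (cases "w fk = 0")
    case True
    then have "fk \<in> U" using ne fK by (simp add: U_iff)
    then have x'kU: "x' k \<in> U" unfolding x'k using mU xU[OF k] by (intro U_divide)
    have "x k \<in> loc w n x'"
    proof -
      have eq: "x k = fk / (m * x' k)"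
        using ne mU xU[OF k] by (simp add: x'k U_iff)
      have "fk \<in> loc w n x'"
        using evalF_loc[OF LP_seedD(2)[OF S k], of x'] F_eq by simp
      moreover have "evalF x' (exch_den n F k {}) \<in> loc w n x'"
        by (rule loc_evalF_on[OF vars_exch_den]) (simp add: loc_var)
      then have "m \<in> loc w n x'" using m_eq[of x'] x'l by simp
      ultimately have "fk / (m * x' k) \<in> loc w n x'"
        by (intro U_loc_divide loc_mult loc_var U_mult mU x'kU k)
      then show ?thesis using eq by simp
    qed
    then have "x l \<in> loc w n x'" "x' l \<in> U" if "l < n" for l
      using that x'kU xU x'l[of l] loc_var[of l n x' w] by (cases "l = k"; simp)+
    then have "centred n x'" using centred_transfer_U[OF x] by blast
    then show ?thesis by (simp add: adapted_def)
  next
    case False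
    define c where "c = to_fr (Const u)"
    have cU: "c \<in> U" unfolding c_def using u by (intro U_unit)
    have f'k: "evalF x' (F' k) = c * fk" by (simp add: u F_eq c_def)
    define z where "z = x'(k := x' k / evalF x' (F' k))"
    have zk: "z k = 1 / (c * m * x k)" using ne by (simp add: z_def f'k x'k)
    have zl: "z l = x l" if "l < n" "l \<noteq> k" for l using that x'l by (simp add: z_def)
    have zkU: "z k \<in> U" unfolding zk using cU mU xU[OF k] by (intro U_divide U_mult U_one)
    have "x k \<in> loc w n z"
    proof -
      have eq: "x k = 1 / (c * m * z k)" using cU mU xU[OF k] by (simp add: zk U_iff)
      have "evalF z (exch_den n F k {}) \<in> loc w n z"
        by (rule loc_evalF_on[OF vars_exch_den]) (simp add: loc_var)
      then have "m \<in> loc w n z" using m_eq[of z] zl by simp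
      moreover have "c \<in> loc w n z" unfolding c_def by (rule loc_const)
      ultimately have "1 / (c * m * z k) \<in> loc w n z"
        by (intro U_loc_divide loc_mult loc_var U_mult loc_one mU zkU k cU)
      then show ?thesis using eq by simp
    qed
    then have "x l \<in> loc w n z" "z l \<in> U" if "l < n" for l
      using that zkU xU zl[of l] loc_var[of l n z w] by (cases "l = k"; simp)+
    then have "centred n z" using centred_transfer_U[OF x] by blast
    moreover have "0 < w (evalF x' (F' k))"
      unfolding f'k using False U_K_mult[OF cU fK(1) ne] fK(2) by simp
    ultimately show ?thesis using k by (auto simp: adapted_def exc_centred_def z_def)
  qed
qed

text \<open>Mutation in the exceptional direction passes to the blown-up chart: x'_k = 1 / (m z_k),
  so x'_k is a unit and gives back z_k.\<close>

lemma exc_centred_mutation_same: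
  assumes mut: "LP_mutation n k (x, F) (x', F')"
    and k: "k < n" and x: "exc_centred n x F k"
  shows "centred n x'"
proof -
  define z where "z = x(k := x k / evalF x (F k))"
  have z: "centred n z" using x by (simp add: exc_centred_def z_def)
  note zU = centred_U[OF z]
  define m where "m = evalF x (exch_den n F k {})"
  have xU: "x l \<in> U" if "l < n" "l \<noteq> k" for l using zU[OF that(1)] that by (simp add: z_def)
  have mU: "m \<in> U" unfolding m_def by (intro U_exch_den xU)
  define fk where "fk = evalF x (F k)"
  have x'k: "x' k = fk / m / x k" and x'l: "\<And>l. l < n \<Longrightarrow> l \<noteq> k \<Longrightarrow> x' l = x l"
    using mut by (auto simp: LP_mutation_def hatF_def Let_def fk_def m_def)
  have zk: "z k = x k / fk" by (simp add: z_def fk_def)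
  have ne: "fk \<noteq> 0" "x k \<noteq> 0" using zU[OF k] by (auto simp: zk U_iff)
  have x'k_eq: "x' k = 1 / (m * z k)" unfolding x'k zk by simp
  have x'kU: "x' k \<in> U" unfolding x'k_eq by (intro U_divide U_mult U_one mU zU k)
  have m_eq: "m = evalF x' (exch_den n F k {})"
    unfolding m_def by (rule evalF_eq_on[OF vars_exch_den]) (simp add: x'l)
  have m_loc: "m \<in> loc w n x'"
    unfolding m_eq by (rule loc_evalF_on[OF vars_exch_den]) (simp add: loc_var)
  have "1 / (m * x' k) \<in> loc w n x'"
    by (intro U_loc_divide loc_mult loc_var U_mult loc_one mU x'kU k m_loc)
  moreover have "1 / (m * x' k) = z k" unfolding x'k_eq using mU by (simp add: U_iff)
  ultimately have zk_loc: "z k \<in> loc w n x'" by simp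
  show ?thesis
  proof (rule centred_transfer_U[OF z])
    fix l assume l: "l < n"
    show "x' l \<in> U" using l x'kU xU[of l] x'l[of l] by (cases "l = k") simp_all
    have "z l = x' l" if "l \<noteq> k" using that l x'l[of l] by (simp add: z_def)
    then show "z l \<in> loc w n x'" using l zk_loc loc_var[of l n x' w] by (cases "l = k") simp_all
  qed
qed

text \<open>The exchange exponent a is the power of F_k that F_j acquires under x_k = z_k F_k, so
  division by x_k^a makes x'_j a unit. The new F'_k keeps the value of F_k because its recipe uses
  F_j at x_k = 0, which differs from F_j by a multiple of x_k, and because the factors removed from
  it are units.\<close>

lemma exc_centred_mutation_other:
  assumes S: "is_LP_seed n (x, F)" and S': "is_LP_seed n (x', F')"
    and mut: "LP_mutation n j (x, F) (x', F')"
    and k: "k < n" and j: "j < n" "j \<noteq> k" and x: "exc_centred n x F k"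
  shows "exc_centred n x' F' k"
proof -
  define fk where "fk = evalF x (F k)"
  define z where "z = x(k := x k / fk)"
  have z: "centred n z" and wfk: "0 < w fk"
    using x by (simp_all add: exc_centred_def z_def fk_def)
  note zU = centred_U[OF z]
  have xU: "x l \<in> U" if "l < n" "l \<noteq> k" for l using zU[OF that(1)] that by (simp add: z_def)
  have zl: "z l = x l" if "l \<noteq> k" for l using that by (simp add: z_def)
  have zk: "z k = x k / fk" by (simp add: z_def)
  note Fk = LP_seedD(2-5)[OF S k] and Fj = LP_seedD(2-5)[OF S j(1)]
  have Fk0: "F k \<noteq> 0" and Fj0: "F j \<noteq> 0" using Fk(2) Fj(2) by (auto simp: irreducible_def)
  have ne: "fk \<noteq> 0" "x k \<noteq> 0" using zU[OF k] by (auto simp: zk U_iff)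
  have fk_z: "evalF z (F k) = fk"
    unfolding fk_def by (rule evalF_eq_on[OF LP_seed_vars[OF S k]]) (simp add: zl)
  have fkK: "fk \<in> K"
    unfolding fk_z[symmetric] using zU by (intro evalF_in_K[OF Fk(1)]) (simp add: U_iff)
  have xk: "x k = z k * fk" using ne by (simp add: zk)
  have indep: "alg_indep n z"
    unfolding z_def fk_def by (rule alg_indep_divide[OF LP_seedD(1)[OF S] k Fk0 Fk(1,3)])
  have not_dvd_U: "evalF z p \<in> U" if "in_vars n p" "\<not> F k dvd p" for p
  proof -
    have "p \<noteq> 0" using that(2) by auto
    then have "evalF z p \<noteq> 0" using indep that(1) by (auto simp: alg_indep_def)
    moreover have "w (evalF z p) = 0"
      using centred_dvd[OF z indep Fk(2,1) _ that(1) \<open>p \<noteq> 0\<close>] that(2) wfk fk_z by auto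
    moreover have "evalF z p \<in> K" using zU by (intro evalF_in_K[OF that(1)]) (simp add: U_iff)
    ultimately show ?thesis by (simp add: U_iff)
  qed
  \<comment> \<open>Since x_k = z_k F_k, this rewrites polynomials in x as polynomials in z. It is
    the substitution in \<open>exch_exp\<close>, with z_k in the role of the indeterminate that
    stands for the inverse of x'_k.\<close>
  define \<psi> where "\<psi> = subst_mp (\<lambda>l. if l = k then F k * Var k else Var l)"
  have psi_z: "evalF z (\<psi> p) = evalF x p" for p
    unfolding \<psi>_def evalF_subst
    by (rule evalF_cong) (simp add: fk_z xk zl)
  have psi_vars: "vars (\<psi> p) \<subseteq> vars p \<union> vars (F k)" for p
    unfolding \<psi>_def
  proof (rule vars_subst_mp)
    fix l assume "l \<in> vars p"
    then show "vars (if l = k then F k * Var k else Var l) \<subseteq> vars p \<union> vars (F k)"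
      using vars_mult[of "F k" "Var k"] by (auto simp: vars_Var)
  qed
  have in_vars_psi: "in_vars n (\<psi> p)" if "in_vars n p" for p
    using psi_vars[of p] that Fk(1) by (auto simp: in_vars_def)
  define \<sigma> where "\<sigma> = subst_mp (\<lambda>l. if l = k then 0 else Var l :: 'a mpoly)"
  have sigma_Fk: "\<sigma> (F k) = F k"
    unfolding \<sigma>_def by (rule subst_mp_cong_Var) (use Fk(3) in auto)
  have sigma_dvd: "F k dvd \<sigma> p" if "F k dvd p" for p
    using ring_hom_dvd[OF ring_hom_subst_mp that, of "\<lambda>l. if l = k then 0 else Var l"] sigma_Fk
    by (simp add: \<sigma>_def)
  define P where "P = \<sigma> (F j)"
  \<comment> \<open>X_k goes to F_k X_k and then to 0, so composing with \<open>\<psi>\<close> does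
    not change \<open>\<sigma>\<close>.\<close>
  have sigma_psi: "\<sigma> (\<psi> (F j)) = P"
    unfolding P_def \<sigma>_def \<psi>_def subst_mp_subst
    by (rule arg_cong[where f = "\<lambda>s. subst_mp s (F j)"]) (auto simp: subst_mp_simps fun_eq_iff)
  have fj0: "evalF x (F j) \<noteq> 0" using LP_seedD(1)[OF S] Fj(1) Fj0 by (auto simp: alg_indep_def)
  then have psi_Fj0: "\<psi> (F j) \<noteq> 0" using psi_z[of "F j"] by auto
  obtain a H where H: "\<psi> (F j) = F k ^ a * H" "\<not> F k dvd H"
    using prime_power_decomposition[OF psi_Fj0 Fk(2)] .
  have exp: "exch_exp F j k = a"
    unfolding exch_exp_mpmult using mpmult_eqI[OF Fk0 H(2,1)] by (simp add: \<psi>_def)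
  have H_vars: "vars H \<subseteq> vars (F j) \<union> vars (F k)"
    using vars_dvd[of H "\<psi> (F j)"] psi_Fj0 psi_vars[of "F j"] H(1) by auto
  then have H_in: "in_vars n H" using Fj(1) Fk(1) by (auto simp: in_vars_def)
  have HU: "evalF z H \<in> U" by (rule not_dvd_U[OF H_in H(2)])
  have fj: "evalF x (F j) = fk ^ a * evalF z H"
    unfolding psi_z[symmetric] H(1) by (simp add: fk_z)
  define d where "d = exch_den n F j {k}"
  define m where "m = evalF x d"
  have d_vars: "vars d \<subseteq> {..<n} - {j, k}" unfolding d_def using vars_exch_den[of n F j "{k}"] by auto
  have mU: "m \<in> U" unfolding m_def d_def by (rule U_exch_den) (simp add: xU)
  have x'j: "x' j = evalF x (F j) / (x k ^ a * m) / x j"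
    and x'l: "\<And>l. l < n \<Longrightarrow> l \<noteq> j \<Longrightarrow> x' l = x l"
    using mut exch_den_split[OF k j(2)[symmetric], of F] exp
    by (auto simp: LP_mutation_def hatF_def Let_def m_def d_def)
  \<comment> \<open>The a factors F_k of F_j cancel against those contained in x_k^a; only units are
    left.\<close>
  have x'j_eq: "x' j = evalF z H / (z k ^ a * m) / x j"
    unfolding x'j fj xk using ne by (simp add: power_mult_distrib)
  have x'jU: "x' j \<in> U"
    unfolding x'j_eq using HU zU[OF k] mU xU[OF j] by (intro U_divide U_mult U_power)
  have x'U: "x' l \<in> U" if "l < n" "l \<noteq> k" for l
    using that x'jU x'l[of l] xU[of l] by (cases "l = j") simp_all
  have x'k: "x' k = x k" using x'l[OF k] j by simp
  have xj_eq: "x j = evalF z H / (z k ^ a * m * x' j)"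
    unfolding x'j_eq using HU zU[OF k] mU xU[OF j] by (simp add: U_iff)
  define f'k where "f'k = evalF x' (F' k)"
  define z' where "z' = x'(k := x' k / f'k)"
  have z'l: "z' l = x' l" if "l \<noteq> k" for l using that by (simp add: z'_def)
  have z'k: "z' k = x k / f'k" by (simp add: z'_def x'k)
  have x'_loc: "x' l \<in> loc w n z'" if "l < n" "l \<noteq> k" for l
    using loc_var[OF that(1), of z' w] z'l[OF that(2)] by simp
  have m_eq: "evalF x' d = m"
    unfolding m_def by (rule evalF_eq_on[OF d_vars]) (simp add: x'l)
  have m_loc: "m \<in> loc w n z'"
    unfolding m_eq[symmetric] by (rule loc_evalF_on[OF d_vars]) (simp add: x'_loc)
  have main: "f'k \<in> K \<and> f'k \<noteq> 0 \<and> w f'k = w fk \<and> z k \<in> loc w n z' \<and> x j \<in> loc w n z'"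
  proof (cases "j \<in> vars (F k)")
    case False
    obtain u where u: "u dvd 1" "F' k = Const u * F k"
      using mut k j False by (auto simp: LP_mutation_def Let_def)
    define c where "c = to_fr (Const u)"
    have cU: "c \<in> U" unfolding c_def using u by (intro U_unit)
    have vFk: "vars (F k) \<subseteq> {..<n} - {j, k}" using LP_seed_vars[OF S k] False by auto
    have "evalF x' (F k) = fk"
      unfolding fk_def by (rule evalF_eq_on[OF vFk]) (simp add: x'l)
    then have f'k: "f'k = c * fk" by (simp add: f'k_def u c_def)
    then have "z k = c * z' k" using cU by (simp add: zk z'k U_iff)
    moreover have "c * z' k \<in> loc w n z'" unfolding c_def by (intro loc_mult loc_const loc_var k)
    ultimately have zk_loc: "z k \<in> loc w n z'" by simp
    \<comment> \<open>Neither F_j nor F_k involves x_j here, so H is evaluated at coordinates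
      already recovered.\<close>
    have vH: "vars H \<subseteq> {..<n} - {j}"
      using H_vars vFk LP_seed_vars[OF S j(1)] by auto
    have "evalF z H \<in> loc w n z'"
    proof (rule loc_evalF_on[OF vH])
      fix l assume l: "l \<in> {..<n} - {j}"
      then show "z l \<in> loc w n z'"
        using zk_loc x'_loc[of l] zl[of l] x'l[of l] by (cases "l = k") simp_all
    qed
    then have "x j \<in> loc w n z'"
      unfolding xj_eq using j k
      by (intro U_loc_divide loc_mult loc_power U_mult U_power zk_loc m_loc x'_loc zU mU x'U) simp_all
    then show ?thesis using zk_loc U_K_mult[OF cU fkK ne(1)] by (simp add: f'k)
  next
    case True
    have P_vars: "vars P \<subseteq> {..<n} - {j, k}"
    proof -
      have "vars P \<subseteq> vars (F j)"
        unfolding P_def \<sigma>_def by (rule vars_subst_mp) (auto simp: vars_Var)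
      moreover have "k \<notin> vars P" unfolding P_def \<sigma>_def by (rule notin_vars_subst_zero)
      ultimately show ?thesis using LP_seed_vars[OF S j(1)] by auto
    qed
    have P_in: "in_vars n P" using P_vars by (auto simp: in_vars_def)
    have Vk: "Var k dvd F j - P" unfolding P_def \<sigma>_def by (rule Var_dvd_diff_subst_zero)
    have P0: "P \<noteq> 0" using Vk Fj(4)[OF k] by auto
    \<comment> \<open>F_k involves x_j and P does not. This makes P a unit at the centre and forces
      a = 0, so that F_j is a unit as well.\<close>
    have P_ndvd: "\<not> F k dvd P" using vars_dvd[OF _ P0, of "F k"] P_vars True by auto
    have "\<not> F k dvd \<psi> (F j)" using sigma_dvd[of "\<psi> (F j)"] sigma_psi P_ndvd by auto
    then have a0: "a = 0" using H(1) by (cases a) auto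
    define fj where "fj = evalF x (F j)"
    define pz where "pz = evalF x P"
    have fj_eq: "fj = evalF z H" using fj a0 by (simp add: fj_def)
    have fjU: "fj \<in> U" using HU fj_eq by simp
    have P_eq: "evalF z P = pz" "evalF x' P = pz"
      unfolding pz_def by (rule evalF_eq_on[OF P_vars]; simp add: zl x'l)+
    have pzU: "pz \<in> U" using not_dvd_U[OF P_in P_ndvd] P_eq by simp
    \<comment> \<open>Modulo x_k, F_j is P. So F_k with x_j replaced by P x_j / F_j has, after clearing denominators,
      the form P^N F_k + x_k \<Theta>, and its quotient by F_k has value 0: its residue is a polynomial
      with constant term P^N in the residue of x_k / F_k, which is transcendental.\<close>
    define N where "N = degv j (F k)"
    define \<Gamma> where "\<Gamma> = homog j (F k) (P * Var j) (F j)"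
    have "Var k dvd \<Gamma> - homog j (F k) (P * Var j) P" unfolding \<Gamma>_def by (rule homog_diff_dvd[OF Vk])
    then have "Var k dvd \<Gamma> - P ^ N * F k" by (simp add: homog_Var N_def)
    then obtain \<Theta> where \<Theta>: "\<Gamma> - P ^ N * F k = Var k * \<Theta>" by (elim dvdE)
    have \<Gamma>_in: "in_vars n \<Gamma>"
      unfolding \<Gamma>_def using Fk(1) Fj(1) P_in j
      by (intro in_vars_homog in_vars_mult in_vars_Var)
    then have "in_vars n (\<Gamma> - P ^ N * F k)"
      using P_in Fk(1) by (intro in_vars_diff in_vars_mult in_vars_power)
    then have \<Theta>_in: "in_vars n \<Theta>"
      using in_vars_dvd[of \<Theta> "Var k * \<Theta>" n] \<Theta> by (cases "\<Theta> = 0") auto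
    define \<theta> where "\<theta> = evalF x \<Theta>"
    \<comment> \<open>F'_k will equal this element up to a unit: the recipe substitutes P / (d
      x'_j), which is P x_j / F_j because x'_j = F_j / (m x_j).\<close>
    define g where "g = evalF (x(j := pz * x j / fj)) (F k)"
    have "evalF x \<Gamma> = fj ^ N * g"
      unfolding \<Gamma>_def using evalF_homog[of x "F j" j "F k" "P * Var j"] fj0
      by (simp add: fj_def N_def g_def pz_def)
    moreover have "evalF x \<Gamma> = pz ^ N * fk + x k * \<theta>"
    proof -
      have "\<Gamma> = P ^ N * F k + Var k * \<Theta>" using \<Theta> by (simp add: algebra_simps)
      then show ?thesis by (simp add: pz_def fk_def \<theta>_def)
    qed
    ultimately have g_eq: "fj ^ N * g = pz ^ N * fk + x k * \<theta>" by simp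
    define T where "T = pz ^ N + z k * \<theta>"
    have TU: "T \<in> U"
    proof -
      have "\<not> F k dvd P ^ N + Var k * \<psi> \<Theta>"
      proof
        assume "F k dvd P ^ N + Var k * \<psi> \<Theta>"
        then have "F k dvd \<sigma> (P ^ N + Var k * \<psi> \<Theta>)" by (rule sigma_dvd)
        moreover have "\<sigma> P = P" unfolding \<sigma>_def
          by (rule subst_mp_cong_Var) (use P_vars in auto)
        then have "\<sigma> (P ^ N + Var k * \<psi> \<Theta>) = P ^ N"
          by (simp add: \<sigma>_def subst_mp_simps)
        ultimately have "F k dvd P"
          using irreducible_imp_prime_elem_mpoly[OF Fk(2)] prime_elem_dvd_power by auto
        then show False using P_ndvd by simp
      qed
      moreover have "in_vars n (P ^ N + Var k * \<psi> \<Theta>)"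
        using P_in \<Theta>_in in_vars_psi k
        by (intro in_vars_add in_vars_mult in_vars_power in_vars_Var) auto
      ultimately have "evalF z (P ^ N + Var k * \<psi> \<Theta>) \<in> U" by (intro not_dvd_U)
      then show ?thesis by (simp add: T_def P_eq psi_z \<theta>_def)
    qed
    have "fj ^ N * g = fk * T" unfolding g_eq T_def xk by (simp add: algebra_simps)
    then have g_eq2: "g = (T / fj ^ N) * fk" using fjU by (simp add: U_iff field_simps)
    have gw: "g \<in> K" "g \<noteq> 0" "w g = w fk"
      using U_K_mult[OF U_divide[OF TU U_power[OF fjU]] fkK ne(1), of N] by (simp_all add: g_eq2)
    have nep: "new_exch_poly n F j k (F' k)"
      using mut k j True by (auto simp: LP_mutation_def Let_def)
    \<comment> \<open>The recipe for F'_k lives in the indeterminates. Clearing denominators turns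
      it into a polynomial identity, which is then evaluated at the new cluster.\<close>
    define X :: "nat \<Rightarrow> 'a ratfun" where "X = (\<lambda>l. to_fr (Var l))"
    have X: "evalF X p = to_fr p" for p unfolding X_def by (rule evalF_to_fr_Var)
    define G where "G = evalF (X(j := to_fr P / to_fr d / to_fr (Var j))) (F k)"
    have G_def': "eval_mp (\<lambda>c. to_fr (Const c))
        (\<lambda>l. if l = j then to_fr P / to_fr d / to_fr (Var j) else to_fr (Var l)) (F k) = G"
      unfolding G_def evalF_def X_def fun_upd_def ..
    note nep' = nep[unfolded new_exch_poly_def Let_def, folded \<sigma>_def, folded P_def d_def, unfolded G_def']
    obtain D u \<alpha> \<beta> where D: "D \<noteq> 0" "in_vars n D"
      and D_P: "\<forall>q. irreducible q \<longrightarrow> q dvd D \<longrightarrow> proper_factor n q \<and> q dvd P"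
      and u: "u dvd 1" and \<alpha>: "Poly_Mapping.keys \<alpha> \<subseteq> {..<n} - {k}"
      and \<beta>: "Poly_Mapping.keys \<beta> \<subseteq> {..<n} - {k}"
      and F'k: "to_fr (F' k) = to_fr (Const u) * to_fr (monom1 \<alpha>) / to_fr (monom1 \<beta>) * (G / to_fr D)"
      using nep' by (elim exE conjE) (rule that)
    define B where "B = d * Var j"
    have d0: "d \<noteq> 0" using mU by (auto simp: m_def U_iff)
    have B0: "to_fr B \<noteq> 0" using d0 by (simp add: B_def)
    have \<beta>0: "monom1 \<beta> \<noteq> (0 :: 'a mpoly)"
      by (metis keys_single keys_zero monom1_def insert_not_empty one_neq_zero)
    have "to_fr (homog j (F k) P B) = to_fr B ^ N * G"
      using evalF_homog[of X B j "F k" P] B0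
      by (simp add: X N_def G_def B_def to_fr_mult) (simp add: X_def)
    then have "to_fr (F' k * monom1 \<beta> * D * B ^ N) = to_fr (Const u * monom1 \<alpha> * homog j (F k) P B)"
      using \<beta>0 D(1) by (simp add: to_fr_mult ring_hom_power[OF ring_hom_to_fr] F'k)
    then have poly_eq: "F' k * monom1 \<beta> * D * B ^ N = Const u * monom1 \<alpha> * homog j (F k) P B"
      by simp
    define b where "b = evalF x' B"
    have b_eq: "b = fj / x j" and b0: "b \<noteq> 0"
      using mU x'jU fjU xU[OF j]
      by (simp_all add: b_def B_def m_eq x'j a0 fj_def[symmetric] U_iff)
    have "evalF x' (homog j (F k) P B) = b ^ N * evalF (x'(j := pz / b)) (F k)"
      using evalF_homog[of x' B j "F k" P] b0 by (simp add: b_def N_def P_eq)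
    also have "evalF (x'(j := pz / b)) (F k) = g"
      unfolding g_def by (rule evalF_eq_on[OF LP_seed_vars[OF S k]]) (simp add: x'l b_eq)
    finally have hom_eq: "evalF x' (homog j (F k) P B) = b ^ N * g" .
    define c \<alpha>' \<beta>' D' where "c = to_fr (Const u)" and "\<alpha>' = evalF x' (monom1 \<alpha>)"
      and "\<beta>' = evalF x' (monom1 \<beta>)" and "D' = evalF x' D"
    have "f'k * \<beta>' * D' * b ^ N = c * \<alpha>' * (b ^ N * g)"
      using arg_cong[OF poly_eq, of "evalF x'"]
      by (simp add: f'k_def \<beta>'_def D'_def b_def c_def \<alpha>'_def hom_eq)
    then have f'k_eq: "f'k * \<beta>' * D' = c * \<alpha>' * g" using b0 by (simp add: mult.assoc)
    \<comment> \<open>D involves only variables of P, which take the same values in x, x' and z; and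
      F_k does not divide D because it does not divide P. So the removed factor is a unit.\<close>
    have "\<exists>M. D dvd P ^ M"
      by (rule dvd_power_of_irreducible_factors[OF D(1)]) (simp add: D_P)
    then obtain M where "D dvd P ^ M" ..
    then have D_vars: "vars D \<subseteq> {..<n} - {j, k}"
      using vars_dvd[of D "P ^ M"] P0 vars_power[of P M] P_vars by auto
    have "evalF z D = D'"
      unfolding D'_def by (rule evalF_eq_on[OF D_vars]) (simp add: zl x'l)
    moreover have "\<not> F k dvd D" using D_P Fk(2) P_ndvd by blast
    ultimately have D'U: "D' \<in> U" using not_dvd_U[OF D(2)] by simp
    have \<alpha>'U: "\<alpha>' \<in> U" unfolding \<alpha>'_def using \<alpha> by (intro U_monom1 x'U) auto
    have \<beta>'U: "\<beta>' \<in> U" unfolding \<beta>'_def using \<beta> by (intro U_monom1 x'U) auto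
    have cU: "c \<in> U" unfolding c_def using u by (intro U_unit)
    have "f'k = (c * \<alpha>' * g) / (\<beta>' * D')"
      unfolding f'k_eq[symmetric] using \<beta>'U D'U by (simp add: U_iff)
    then have f'k_eq2: "f'k = (c * \<alpha>' / (\<beta>' * D')) * g" by simp
    have "c * \<alpha>' / (\<beta>' * D') \<in> U" by (intro U_divide U_mult cU \<alpha>'U \<beta>'U D'U)
    from U_K_mult[OF this gw(1,2)] have f'k: "f'k \<in> K \<and> f'k \<noteq> 0 \<and> w f'k = w fk"
      unfolding f'k_eq2 gw(3) .
    have z'kU: "z' k \<in> U"
      using f'k fkK ne zU[OF k]
      by (simp add: z'k xk U_iff K_divide K_mult w_divide w_mult)
    \<comment> \<open>F'_k avoids x_k and F_j avoids x_j, so the old coordinates can be recovered in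
      turn: x_k as z'_k F'_k, then x_j from F_j, and z_k last.\<close>
    have "f'k \<in> loc w n z'"
      unfolding f'k_def by (rule loc_evalF_on[OF LP_seed_vars[OF S' k]]) (simp add: x'_loc)
    then have "z' k * f'k \<in> loc w n z'" by (intro loc_mult loc_var k)
    then have xk_loc: "x k \<in> loc w n z'" using f'k by (simp add: z'k)
    have x_loc: "x l \<in> loc w n z'" if "l < n" "l \<noteq> j" for l
      using that xk_loc x'_loc[of l] x'l[of l] by (cases "l = k") simp_all
    have fj_loc: "fj \<in> loc w n z'"
      unfolding fj_def by (rule loc_evalF_on[OF LP_seed_vars[OF S j(1)]]) (simp add: x_loc)
    have "fj / (m * x' j) \<in> loc w n z'"
      using j by (intro U_loc_divide loc_mult U_mult fj_loc m_loc x'_loc mU x'U) simp_all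
    then have xj_loc: "x j \<in> loc w n z'" using xj_eq a0 fj_eq by simp
    have x_loc': "x l \<in> loc w n z'" if "l < n" for l
      using x_loc[of l] xj_loc that by (cases "l = j") simp_all
    have \<theta>_loc: "\<theta> \<in> loc w n z'"
      unfolding \<theta>_def using \<Theta>_in by (intro loc_evalF x_loc') (auto simp: in_vars_def)
    have pz_loc: "pz \<in> loc w n z'"
      unfolding pz_def using P_in by (intro loc_evalF x_loc') (auto simp: in_vars_def)
    have D'_loc: "D' \<in> loc w n z'"
      unfolding D'_def by (rule loc_evalF_on[OF D_vars]) (simp add: x'_loc)
    have \<alpha>'_loc: "\<alpha>' \<in> loc w n z'"
      unfolding \<alpha>'_def by (rule loc_evalF_on[OF vars_monom1[OF \<alpha>]]) (simp add: x'_loc)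
    have \<beta>'_loc: "\<beta>' \<in> loc w n z'"
      unfolding \<beta>'_def by (rule loc_evalF_on[OF vars_monom1[OF \<beta>]]) (simp add: x'_loc)
    have c_loc: "c \<in> loc w n z'" unfolding c_def by (rule loc_const)
    \<comment> \<open>This solves \<open>g_eq\<close> for F_k / x_k = 1 / z_k, with g / x_k
      expressed through z'_k and the unit factors linking g to F'_k.\<close>
    define e where "e = (fj ^ N * (\<beta>' * D' / (c * \<alpha>' * z' k)) - \<theta>) / pz ^ N"
    have e_loc: "e \<in> loc w n z'"
      unfolding e_def
      by (intro U_loc_divide loc_diff loc_mult loc_power loc_var k U_mult U_power fj_loc \<beta>'_loc D'_loc
          c_loc \<alpha>'_loc \<theta>_loc pz_loc cU \<alpha>'U z'kU pzU)
    have "g = f'k * \<beta>' * D' / (c * \<alpha>')"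
      unfolding f'k_eq using cU \<alpha>'U by (simp add: U_iff)
    then have "g / x k = \<beta>' * D' / (c * \<alpha>' * z' k)" using f'k by (simp add: z'k)
    moreover have "fj ^ N * (g / x k) - \<theta> = (pz ^ N * fk + x k * \<theta>) / x k - \<theta>"
      unfolding g_eq[symmetric] by simp
    then have "fj ^ N * (g / x k) - \<theta> = pz ^ N / z k"
      using ne by (simp add: zk add_divide_distrib)
    ultimately have e_eq: "e = 1 / z k"
      using pzU by (simp add: e_def U_iff)
    then have "1 / e \<in> loc w n z'"
      using e_loc zU[OF k] by (intro U_loc_divide loc_one) (simp_all add: U_divide U_one)
    then have "z k \<in> loc w n z'" by (simp add: e_eq)
    then show ?thesis using f'k xj_loc by simp
  qed
  have z'U: "z' l \<in> U" if "l < n" for l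
  proof (cases "l = k")
    case True
    show ?thesis
      using main fkK ne zU[OF k]
      by (simp add: True z'k xk U_iff K_divide K_mult w_divide w_mult)
  qed (use that z'l x'U in simp)
  have "centred n z'"
  proof (rule centred_transfer_U[OF z z'U])
    fix l assume l: "l < n"
    show "z l \<in> loc w n z'"
      using main l x'_loc[of l] x'l[of l] zl[of l]
      by (cases "l = k"; cases "l = j") simp_all
  qed
  then show ?thesis using main wfk by (simp add: exc_centred_def z'_def f'k_def)
qed

end

section \<open>Clusters determine seeds\<close>

context valuation_on
begin

lemma adapted_mutation:
  assumes "is_LP_seed n (x, F)" "is_LP_seed n (x', F')" "LP_mutation n k (x, F) (x', F')"
    and "k < n" "adapted n x F"
  shows "adapted n x' F'"
proof (cases "centred n x")
  case True
  then show ?thesis using assms by (intro centred_mutation)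
next
  case False
  then obtain l where l: "l < n" "exc_centred n x F l" using assms(5) by (auto simp: adapted_def)
  show ?thesis
  proof (cases "l = k")
    case True
    then have "centred n x'" using exc_centred_mutation_same[OF assms(3)] l by simp
    then show ?thesis by (simp add: adapted_def)
  next
    case False
    then have "exc_centred n x' F' l"
      using exc_centred_mutation_other[OF assms(1-3) l(1) assms(4) _ l(2)] by simp
    then show ?thesis using l(1) by (auto simp: adapted_def)
  qed
qed

lemma exc_centred_val:
  assumes S: "is_LP_seed n (x, F)" and k: "k < n" and x: "exc_centred n x F k"
  shows "0 < w (x k)" "x k \<in> K" "x k \<noteq> 0"
proof -
  define z where "z = x(k := x k / evalF x (F k))"
  have z: "centred n z" and wF: "0 < w (evalF x (F k))"
    using x by (simp_all add: exc_centred_def z_def)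
  have zU: "x k / evalF x (F k) \<in> U" using centred_U[OF z k] by (simp add: z_def)
  have eq: "evalF z (F k) = evalF x (F k)"
    by (rule evalF_eq_on[OF LP_seed_vars[OF S k]]) (simp add: z_def)
  have F: "evalF x (F k) \<in> K" "evalF x (F k) \<noteq> 0"
    using centred_loc_nonneg(1)[OF z evalF_loc[OF LP_seedD(2)[OF S k]]] eq zU by (auto simp: U_iff)
  have "x k = (x k / evalF x (F k)) * evalF x (F k)" using F by simp
  with U_K_mult[OF zU F] wF show "0 < w (x k)" "x k \<in> K" "x k \<noteq> 0" by simp_all
qed

text \<open>All cluster variables but one are units in the exceptional case, so a variable of
  nonzero value marks the direction. Thus the cluster alone tells which exchange polynomial lies in
  the centre together with its variable.\<close>

lemma adapted_imp_exc_centred: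
  assumes x: "adapted n x F" and i: "i < n" "w (x i) \<noteq> 0"
  shows "exc_centred n x F i"
proof -
  have "\<not> centred n x" using centredD(3)[of n x i] i by auto
  then obtain k where k: "k < n" "exc_centred n x F k" using x by (auto simp: adapted_def)
  then have z: "centred n (x(k := x k / evalF x (F k)))" by (simp add: exc_centred_def)
  have "k = i" using centredD(3)[OF z i(1)] i(2) by (cases "k = i") auto
  then show ?thesis using k by simp
qed

text \<open>A polynomial free of X_k evaluates to the same element at x and at z, and
  \<open>centred_dvd\<close> applies at z.\<close>

lemma exc_centred_dvd:
  assumes S: "is_LP_seed n (x, F)" and k: "k < n" and x: "exc_centred n x F k"
    and p: "in_vars n p" "k \<notin> vars p" "p \<noteq> 0" "w (evalF x p) \<noteq> 0"
  shows "F k dvd p"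
proof -
  define z where "z = x(k := x k / evalF x (F k))"
  have z: "centred n z" and wF: "0 < w (evalF x (F k))"
    using x by (simp_all add: exc_centred_def z_def)
  note Fk = LP_seedD(2-4)[OF S k]
  have "F k \<noteq> 0" using Fk(2) by (auto simp: irreducible_def)
  then have indep: "alg_indep n z"
    unfolding z_def by (intro alg_indep_divide[OF LP_seedD(1)[OF S] k _ Fk(1,3)])
  have eq: "evalF z q = evalF x q" if "k \<notin> vars q" for q
    by (rule evalF_cong) (use that in \<open>auto simp: z_def\<close>)
  show ?thesis
    using centred_dvd[OF z indep Fk(2,1) _ p(1,3)] wF p(4) eq[OF Fk(3)] eq[OF p(2)] by simp
qed

end

section \<open>Connectedness of the tree\<close>

lemma tree_vertex_snoc:
  "tree_vertex n (t @ [k]) \<longleftrightarrow> tree_vertex n t \<and> k < n \<and> (t = [] \<or> last t \<noteq> k)"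
proof -
  have "(\<forall>m. Suc m < length (t @ [k]) \<longrightarrow> (t @ [k]) ! m \<noteq> (t @ [k]) ! Suc m) \<longleftrightarrow>
      (\<forall>m. Suc m < length t \<longrightarrow> t ! m \<noteq> t ! Suc m) \<and> (t = [] \<or> last t \<noteq> k)" (is "?L \<longleftrightarrow> ?R")
  proof
    assume L: ?L
    have "t ! m \<noteq> t ! Suc m" if "Suc m < length t" for m
      using L[rule_format, of m] that by (simp add: nth_append)
    moreover have "last t \<noteq> k" if "t \<noteq> []"
      using L[rule_format, of "length t - 1"] that by (simp add: nth_append last_conv_nth)
    ultimately show ?R by blast
  next
    assume R: ?R
    show ?L
    proof (intro allI impI)
      fix m assume m: "Suc m < length (t @ [k])"
      show "(t @ [k]) ! m \<noteq> (t @ [k]) ! Suc m"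
      proof (cases "Suc m < length t")
        case True
        then show ?thesis using R by (simp add: nth_append)
      next
        case False
        then have "length t = Suc m" using m by simp
        then show ?thesis using R last_conv_nth[of t] by (cases "t = []") (auto simp: nth_append)
      qed
    qed
  qed
  then show ?thesis by (auto simp: tree_vertex_def)
qed

lemma tree_vertex_nbr: "tree_vertex n t \<Longrightarrow> k < n \<Longrightarrow> tree_vertex n (tree_nbr k t)"
  using tree_vertex_snoc[of n "butlast t" k] tree_vertex_snoc[of n t k] append_butlast_last_id[of t]
  by (auto simp: tree_nbr_def)

text \<open>The property is carried from s to the root by deleting last letters, and from the root
  to t by appending letters.\<close>

lemma tree_connected:
  assumes "tree_vertex n s" "Q s" "tree_vertex n t"
    and step: "\<And>t k. tree_vertex n t \<Longrightarrow> k < n \<Longrightarrow> Q t \<Longrightarrow> Q (tree_nbr k t)"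
  shows "Q t"
proof -
  have "Q []"
    using assms(1,2)
  proof (induction s rule: rev_induct)
    case (snoc k s)
    then show ?case using step[of "s @ [k]" k] by (simp add: tree_nbr_def tree_vertex_snoc)
  qed
  show ?thesis
    using assms(3)
  proof (induction t rule: rev_induct)
    case (snoc k t)
    then show ?case using step[of t k] by (auto simp: tree_nbr_def tree_vertex_snoc)
  qed (rule \<open>Q []\<close>)
qed

theorem theorem3p1:
  fixes n :: nat
    and \<Sigma> :: "nat list \<Rightarrow> 'a::{factorial_semiring,idom,ring_char_0} seed"
    and t1 t2 :: "nat list" and \<sigma> :: "nat \<Rightarrow> nat" and r :: "nat \<Rightarrow> 'a"
  assumes "n \<ge> 1"
    and "LP_pattern n \<Sigma>"
    and "tree_vertex n t1" and "tree_vertex n t2"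
    and "bij_betw \<sigma> {..<n} {..<n}"
    and "\<forall>i<n. is_unit (r i) \<and> fst (\<Sigma> t2) i = to_fr (Const (r i)) * fst (\<Sigma> t1) (\<sigma> i)"
  shows "\<forall>i<n. \<exists>r'. is_unit r' \<and>
           evalF (fst (\<Sigma> t2)) (snd (\<Sigma> t2) i) =
           to_fr (Const r') * evalF (fst (\<Sigma> t1)) (snd (\<Sigma> t1) (\<sigma> i))"
proof (intro allI impI)
  fix i assume i: "i < n"
  have seed: "is_LP_seed n (fst (\<Sigma> t), snd (\<Sigma> t))" if "tree_vertex n t" for t
    using assms(2) that by (simp add: LP_pattern_def)
  define x1 F1 x2 F2 where "x1 = fst (\<Sigma> t1)" and "F1 = snd (\<Sigma> t1)"
    and "x2 = fst (\<Sigma> t2)" and "F2 = snd (\<Sigma> t2)"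
  have S1: "is_LP_seed n (x1, F1)" and S2: "is_LP_seed n (x2, F2)"
    using seed assms(3,4) by (simp_all add: x1_def F1_def x2_def F2_def)
  have r: "r l dvd 1" "x2 l = to_fr (Const (r l)) * x1 (\<sigma> l)" if "l < n" for l
    using assms(6) that by (simp_all add: x1_def x2_def)
  have \<sigma>: "\<sigma> l < n" if "l < n" for l using assms(5) that by (auto dest: bij_betwE)
  have inj: "inj_on \<sigma> {..<n}" and surj: "\<sigma> ` {..<n} = {..<n}"
    using assms(5) by (simp_all add: bij_betw_def)
  define \<tau> where "\<tau> = the_inv_into {..<n} \<sigma>"
  have \<tau>: "\<tau> l < n" "\<sigma> (\<tau> l) = l" if "l < n" for l
    using that the_inv_into_into[OF inj, of l "{..<n}"] f_the_inv_into_f[OF inj, of l] surj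
    by (simp_all add: \<tau>_def)
  have \<tau>\<sigma>: "\<tau> (\<sigma> l) = l" if "l < n" for l
    using that the_inv_into_f_f[OF inj, of l] by (simp add: \<tau>_def)
  define k where "k = \<sigma> i"
  have k: "k < n" using \<sigma> i by (simp add: k_def)
  note Fk = LP_seedD(2-5)[OF S1 k] and Fi = LP_seedD(2-5)[OF S2 i]
  have Fk0: "F1 k \<noteq> 0" and Fi0: "F2 i \<noteq> 0" using Fk(2) Fi(2) by (auto simp: irreducible_def)
  define z where "z = x1(k := x1 k / evalF x1 (F1 k))"
  have indep: "alg_indep n z"
    unfolding z_def by (rule alg_indep_divide[OF LP_seedD(1)[OF S1] k Fk0 Fk(1,3)])
  have F_z: "evalF z (F1 k) = evalF x1 (F1 k)"
    by (rule evalF_eq_on[OF LP_seed_vars[OF S1 k]]) (simp add: z_def)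
  obtain K w where "valuation_on K w" and z: "valuation_on.centred K w n z" and "w (evalF z (F1 k)) = 1"
    using adic_valuation_exists[OF indep Fk(2,1)] irreducible_not_dvd_Var[OF Fk(2) Fk(4)] by metis
  then interpret valuation_on K w by simp
  have exc1: "exc_centred n x1 F1 k"
    using z \<open>w (evalF z (F1 k)) = 1\<close> F_z by (simp add: exc_centred_def z_def)
  have "adapted n (fst (\<Sigma> t1)) (snd (\<Sigma> t1))"
    using exc1 k by (auto simp: adapted_def x1_def F1_def)
  then have "adapted n (fst (\<Sigma> t2)) (snd (\<Sigma> t2))"
  proof (rule tree_connected[where Q = "\<lambda>t. adapted n (fst (\<Sigma> t)) (snd (\<Sigma> t))", OF assms(3) _ assms(4)])
    fix t l assume t: "tree_vertex n t" "l < n" "adapted n (fst (\<Sigma> t)) (snd (\<Sigma> t))"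
    show "adapted n (fst (\<Sigma> (tree_nbr l t))) (snd (\<Sigma> (tree_nbr l t)))"
      using adapted_mutation[OF seed[OF t(1)] seed[OF tree_vertex_nbr[OF t(1,2)]] _ t(2,3)] assms(2) t
      by (simp add: LP_pattern_def)
  qed
  then have "adapted n x2 F2" by (simp add: x2_def F2_def)
  \<comment> \<open>x_i of the second seed is a unit times x_k of the first, and the latter has
    positive value.\<close>
  moreover have "w (x2 i) \<noteq> 0"
    using exc_centred_val[OF S1 k exc1] U_K_mult[OF U_unit[OF r(1)[OF i]], of "x1 k"] r(2)[OF i]
    by (simp add: k_def)
  ultimately have exc2: "exc_centred n x2 F2 i" using adapted_imp_exc_centred[OF _ i] by blast

  \<comment> \<open>A is the exchange polynomial of the second seed written in the first cluster; B
    below is that of the first written in the second. Each seed yields one divisibility, and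
    together they make the two polynomials associates.\<close>
  define s where "s l = Const (r l) * Var (\<sigma> l)" for l
  define A where "A = subst_mp s (F2 i)"
  have A_eval: "evalF x1 A = evalF x2 (F2 i)"
    unfolding A_def evalF_subst
    by (rule evalF_eq_on[OF LP_seed_vars[OF S2 i]]) (simp add: s_def r)
  have A_vars: "vars A \<subseteq> {..<n} - {k}"
    unfolding A_def
  proof (rule vars_subst_mp)
    fix l assume "l \<in> vars (F2 i)"
    then have l: "l < n" "l \<noteq> i" using LP_seed_vars[OF S2 i] by auto
    then have "\<sigma> l \<noteq> k" using \<tau>\<sigma>[of l] \<tau>\<sigma>[OF i] by (auto simp: k_def)
    then show "vars (s l) \<subseteq> {..<n} - {k}"
      using vars_mult[of "Const (r l)" "Var (\<sigma> l)"] \<sigma>[OF l(1)] by (auto simp: s_def vars_Var)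
  qed
  have wF2: "0 < w (evalF x2 (F2 i))" using exc2 by (simp add: exc_centred_def)
  have "evalF x2 (F2 i) \<noteq> 0" using LP_seedD(1)[OF S2] Fi(1) Fi0 by (auto simp: alg_indep_def)
  then have "A \<noteq> 0" using A_eval by auto
  then have "F1 k dvd A"
    using A_vars A_eval wF2 by (intro exc_centred_dvd[OF S1 k exc1]) (auto simp: in_vars_def)

  have "\<exists>v. r l * v = 1" if "l < n" for l using r(1)[OF that] by (metis dvdE)
  then obtain r' where r': "r l * r' l = 1" if "l < n" for l by metis
  define s' where "s' l = Const (r' (\<tau> l)) * Var (\<tau> l)" for l
  define B where "B = subst_mp s' (F1 k)"
  have B_eval: "evalF x2 B = evalF x1 (F1 k)"
    unfolding B_def evalF_subst
  proof (rule evalF_eq_on[OF LP_seed_vars[OF S1 k]])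
    fix l assume "l \<in> {..<n} - {k}"
    then have l: "l < n" by simp
    have "to_fr (Const (r' (\<tau> l))) * to_fr (Const (r (\<tau> l))) = 1"
      using r'[OF \<tau>(1)[OF l]] by (simp flip: to_fr_mult Const_mult add: Const_one mult.commute)
    then show "evalF x2 (s' l) = x1 l"
      using r(2)[OF \<tau>(1)[OF l]] \<tau>(2)[OF l] by (simp add: s'_def mult.assoc[symmetric])
  qed
  have B_vars: "vars B \<subseteq> {..<n} - {i}"
    unfolding B_def
  proof (rule vars_subst_mp)
    fix l assume "l \<in> vars (F1 k)"
    then have l: "l < n" "l \<noteq> k" using LP_seed_vars[OF S1 k] by auto
    then have "\<tau> l \<noteq> i" using \<tau>(2)[of l] by (auto simp: k_def)
    then show "vars (s' l) \<subseteq> {..<n} - {i}"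
      using vars_mult[of "Const (r' (\<tau> l))" "Var (\<tau> l)"] \<tau>(1)[OF l(1)] by (auto simp: s'_def vars_Var)
  qed
  have wF1: "0 < w (evalF x1 (F1 k))" using exc1 by (simp add: exc_centred_def)
  have "evalF x1 (F1 k) \<noteq> 0" using LP_seedD(1)[OF S1] Fk(1) Fk0 by (auto simp: alg_indep_def)
  then have "B \<noteq> 0" using B_eval by auto
  then have "F2 i dvd B"
    using B_vars B_eval wF1 by (intro exc_centred_dvd[OF S2 i exc2]) (auto simp: in_vars_def)
  \<comment> \<open>The renaming \<open>s\<close> undoes \<open>s'\<close> on the variables of
    \<open>F1 k\<close>, so it carries the second divisibility back to the first cluster.\<close>
  then have "A dvd subst_mp s B" unfolding A_def by (rule ring_hom_dvd[OF ring_hom_subst_mp])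
  also have "subst_mp s B = F1 k"
    unfolding B_def subst_mp_subst
  proof (rule subst_mp_cong_Var)
    fix l assume "l \<in> vars (F1 k)"
    then have l: "l < n" using LP_seed_vars[OF S1 k] by auto
    have "Const (r' (\<tau> l)) * Const (r (\<tau> l)) = (1 :: 'a mpoly)"
      using r'[OF \<tau>(1)[OF l]] by (simp flip: Const_mult add: Const_one mult.commute)
    then show "subst_mp s (s' l) = Var l"
      using \<tau>(2)[OF l] by (simp add: s'_def s_def subst_mp_simps mult.assoc[symmetric])
  qed
  finally have "A dvd F1 k" .
  then obtain h g where h: "A = F1 k * h" and g: "F1 k = A * g" using \<open>F1 k dvd A\<close> by (metis dvdE)
  have "F1 k * (h * g) = A * g" by (simp only: h mult.assoc)
  then have "F1 k * (h * g) = F1 k * 1" by (simp only: g[symmetric] mult_1_right)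
  then have "h * g = 1" using Fk0 mult_cancel_left[of "F1 k" "h * g" 1] by simp
  then have "h dvd 1" by (metis dvd_triv_left)
  then obtain v where v: "v dvd 1" "h = Const v" by (elim is_unit_mpoly)
  have "evalF x2 (F2 i) = to_fr (Const v) * evalF x1 (F1 k)"
    unfolding A_eval[symmetric] h by (simp add: v)
  then show "\<exists>r'. is_unit r' \<and> evalF (fst (\<Sigma> t2)) (snd (\<Sigma> t2) i) =
      to_fr (Const r') * evalF (fst (\<Sigma> t1)) (snd (\<Sigma> t1) (\<sigma> i))"
    using v by (auto simp: x1_def x2_def F1_def F2_def k_def)
qed

end
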